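(* There exists a constant $C>0$ such that for every $u\in H_0^1(\mathbb{D})$ with $u\ge 0$, $$\log\left(\int_{\mathbb{D}}\frac{e^u-1-u}{(1-|x|^2)^2}\,dx\right)\le C+\frac{1}{16\pi}\|\nabla u\|_2^2 .$$
   Context: $\mathbb{D}$ is the open unit disk in $\mathbb{R}^2$, $H_0^1(\mathbb{D})$ is the usual Sobolev space, and $\|\nabla u\|_2^2=\int_{\mathbb{D}}|\nabla u|^2\,dx$. The convention $\log 0=-\infty$ is used (relevant for $u=0$). *)

theory Defs
  imports "HOL-Analysis.Analysis"
begin

text \<open>
  Sobolev spaces on an open set \<open>\<Omega>\<close>.  Functions are total and only their values on \<open>\<Omega>\<close>
  matter; elements of the usual spaces are classes of these functions modulo equality
  almost everywhere on \<open>\<Omega>\<close>.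
\<close>

definition grad :: "('a::euclidean_space \<Rightarrow> real) \<Rightarrow> 'a \<Rightarrow> 'a" where
  "grad f x = (\<Sum>b\<in>Basis. frechet_derivative f (at x) b *\<^sub>R b)"

fun C_k :: "nat \<Rightarrow> ('a::euclidean_space \<Rightarrow> real) \<Rightarrow> bool" where
  "C_k 0 f \<longleftrightarrow> continuous_on UNIV f"
| "C_k (Suc k) f \<longleftrightarrow>
     (\<forall>x. f differentiable (at x)) \<and> (\<forall>b\<in>Basis. C_k k (\<lambda>x. grad f x \<bullet> b))"

definition test_functions :: "'a::euclidean_space set \<Rightarrow> ('a \<Rightarrow> real) set" where
  "test_functions \<Omega> =
     {\<phi>. (\<forall>k. C_k k \<phi>) \<and> compact (closure {x. \<phi> x \<noteq> 0}) \<and> closure {x. \<phi> x \<noteq> 0} \<subseteq> \<Omega>}"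

definition L2 :: "'a::euclidean_space set \<Rightarrow> ('a \<Rightarrow> 'b::euclidean_space) set" where
  "L2 \<Omega> = {f \<in> borel_measurable (lebesgue_on \<Omega>).
             integrable (lebesgue_on \<Omega>) (\<lambda>x. (norm (f x))\<^sup>2)}"

definition L2_norm :: "'a::euclidean_space set \<Rightarrow> ('a \<Rightarrow> 'b::euclidean_space) \<Rightarrow> real" where
  "L2_norm \<Omega> f = sqrt (LINT x|lebesgue_on \<Omega>. (norm (f x))\<^sup>2)"

definition has_weak_grad ::
    "'a::euclidean_space set \<Rightarrow> ('a \<Rightarrow> real) \<Rightarrow> ('a \<Rightarrow> 'a) \<Rightarrow> bool" where
  "has_weak_grad \<Omega> u g \<longleftrightarrow> u \<in> L2 \<Omega> \<and> g \<in> L2 \<Omega> \<and>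
     (\<forall>\<phi>\<in>test_functions \<Omega>.
        (LINT x|lebesgue_on \<Omega>. u x *\<^sub>R grad \<phi> x) = - (LINT x|lebesgue_on \<Omega>. \<phi> x *\<^sub>R g x))"

text \<open>For open \<open>\<Omega>\<close> the weak gradient is unique almost everywhere on \<open>\<Omega>\<close>, so the choice of
  representative below does not affect integrals over \<open>\<Omega>\<close>.\<close>

definition weak_grad :: "'a::euclidean_space set \<Rightarrow> ('a \<Rightarrow> real) \<Rightarrow> 'a \<Rightarrow> 'a" where
  "weak_grad \<Omega> u = (SOME g. has_weak_grad \<Omega> u g)"

definition H1 :: "'a::euclidean_space set \<Rightarrow> ('a \<Rightarrow> real) set" where
  "H1 \<Omega> = {u. \<exists>g. has_weak_grad \<Omega> u g}"

text \<open>The closure of the test functions in the norm of \<open>H1 \<Omega>\<close>; the weak gradient of a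
  test function is its classical gradient.\<close>

definition H1_0 :: "'a::euclidean_space set \<Rightarrow> ('a \<Rightarrow> real) set" where
  "H1_0 \<Omega> = {u \<in> H1 \<Omega>. \<exists>\<phi>. (\<forall>n. \<phi> n \<in> test_functions \<Omega>) \<and>
     (\<lambda>n. sqrt ((L2_norm \<Omega> (\<lambda>x. u x - \<phi> n x))\<^sup>2 +
                (L2_norm \<Omega> (\<lambda>x. weak_grad \<Omega> u x - grad (\<phi> n) x))\<^sup>2))
       \<longlonglongrightarrow> 0}"

definition unit_disk :: "(real^2) set" where
  "unit_disk = ball 0 1"

text \<open>The logarithm on \<open>[0, \<infinity>]\<close> with \<open>log 0 = -\<infinity>\<close> and \<open>log \<infinity> = \<infinity>\<close>.\<close>

definition log_ennreal :: "ennreal \<Rightarrow> ereal" where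
  "log_ennreal t = (if t = 0 then -\<infinity> else if t = \<infinity> then \<infinity> else ereal (ln (enn2real t)))"

end

theory Submission
  imports Defs
begin

text \<open>
  No rearrangement is used. By density and Fatou's lemma it suffices to treat a test function
  \<open>f\<close>. Let \<open>\<mu> t\<close> be the hyperbolic area of \<open>{f \<ge> t}\<close>, and \<open>E s t\<close> the energy of \<open>f\<close> on \<open>{s < f < t}\<close>.
  Averaging the fundamental theorem of calculus over paths from a point of \<open>{f \<ge> t}\<close> to the
  boundary, and then over the points of \<open>{f \<ge> t}\<close>, gives the capacity estimate
  \<open>4 \<pi> (t - s)\<^sup>2 \<le> E s t * (ln (\<mu> s / \<mu> t) + C)\<close>. It is lossy only in the additive constant, so it can be
  applied boundedly often: combining it for \<open>(1, t\<^sub>0)\<close> and \<open>(t\<^sub>0, t\<^sub>1)\<close> shows that \<open>exp t * \<mu> t\<close> is at most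
  a constant times \<open>\<mu> 1 * exp (E 1 \<infinity> / (16 \<pi>))\<close> and decays exponentially away from a single level, which
  makes it integrable with that bound. Finally \<open>\<mu> 1\<close> and the part of the integral over \<open>{f < 1}\<close> are
  controlled by Hardy's inequality, where \<open>\<mu> 1 \<le> 4 * E 0 1\<close> is absorbed by \<open>exp (E 0 1 / (16 \<pi>))\<close>.
\<close>

subsection \<open>Integrals of powers of the distance\<close>

text \<open>A drop of height \<open>h\<close> between concentric circles of radii
  \<open>r < R\<close> costs Dirichlet energy at least
  \<open>2 * pi * h\<^sup>2 / ln (R / r)\<close>, that is \<open>4 * pi * h\<^sup>2\<close> over the
  logarithm of the ratio of the areas. The capacity estimate keeps this \<open>4 * pi\<close>, and
  \<open>4 * x * y \<le> (x + y)\<^sup>2\<close> turns it into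
  \<open>t - 1 \<le> E 1 t / (16 * pi) + ln (\<mu> 1 / \<mu> t) + C\<close>; this is the origin of
  \<open>16 * pi\<close>. An error added to the logarithm multiplies \<open>exp t * \<mu> t\<close>
  by a constant only, so a potential estimate can replace symmetrization as long as the coefficient
  of the logarithm is sharp. The obstacle: the bound on \<open>exp t * \<mu> t\<close> obtained in
  this way is uniform in \<open>t\<close>, hence not integrable over an unbounded range of levels,
  and a chain of many slabs would compound the constant. What helps is that two levels can both come
  near the bound only if they are close together. The levels start at 1 because the energy controls
  the area of \<open>{f \<ge> 1}\<close>, but not that of \<open>{f > 0}\<close>.\<close>

lemma measurable_mem_ball [measurable (raw)]:
  fixes f :: "'a \<Rightarrow> 'b::euclidean_space"
  assumes [measurable]: "f \<in> borel_measurable M" "c \<in> borel_measurable M" "r \<in> borel_measurable M"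
  shows "Measurable.pred M (\<lambda>x. f x \<in> ball (c x) (r x))"
  unfolding mem_ball by measurable

text \<open>\<open>ennreal\<close> sends negative reals to 0, so only subadditivity holds. The
  summands will be drops of a truncated function along two legs of a path, whose signs are
  unknown.\<close>

lemma ennreal_add_le: "ennreal (a + b) \<le> ennreal a + ennreal b"
  by (cases "0 \<le> a"; cases "0 \<le> b")
     (auto simp: ennreal_neg ennreal_plus[symmetric] simp del: ennreal_plus intro!: ennreal_leI)

lemma nn_integral_affine:
  fixes f :: "'a::euclidean_space \<Rightarrow> ennreal"
  assumes [measurable]: "f \<in> borel_measurable borel" and "c > 0"
  shows "(\<integral>\<^sup>+x. f x \<partial>lborel) = ennreal (c ^ DIM('a)) * (\<integral>\<^sup>+x. f (t + c *\<^sub>R x) \<partial>lborel)"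
  using assms(2)
  by (subst lborel_affine[of c t])
     (auto simp: nn_integral_density nn_integral_distr nn_integral_cmult)

lemma nn_integral_translate:
  fixes f :: "'a::euclidean_space \<Rightarrow> ennreal"
  assumes [measurable]: "f \<in> borel_measurable borel"
  shows "(\<integral>\<^sup>+x. f (t + x) \<partial>lborel) = (\<integral>\<^sup>+x. f x \<partial>lborel)"
  using nn_integral_affine[OF assms, of 1 t] by simp

lemma emeasure_cball_plane:
  fixes x :: "real^2"
  assumes "r \<ge> 0"
  shows "emeasure lborel (cball x r) = ennreal (pi * r^2)"
  using emeasure_cball[OF assms, of x] by (simp add: unit_ball_vol_2)

lemma emeasure_ball_plane:
  fixes x :: "real^2"
  assumes "r \<ge> 0"
  shows "emeasure lborel (ball x r) = ennreal (pi * r^2)"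
  using emeasure_ball[OF assms, of x] by (simp add: unit_ball_vol_2)

text \<open>Writing \<open>1 / d\<close> as \<open>1 / R\<close> plus the integral of
  \<open>1 / s\<^sup>2\<close> over \<open>d \<le> s \<le> R\<close> replaces polar coordinates:
  Fubini reduces the claim to areas of disks. The constant is the exact one.\<close>

lemma nn_integral_inverse_dist_ball:
  fixes x :: "real^2"
  assumes R: "R > 0"
  shows "(\<integral>\<^sup>+y. ennreal (1 / dist x y) * indicator (ball x R) y \<partial>lborel) \<le> ennreal (2 * pi * R)"
proof -
  let ?F = "\<lambda>y s. indicator {(y, s). dist x y \<le> s} (y, s) * ennreal (1 / s\<^sup>2) * indicator {0<..R} s :: ennreal"
  have mb: "(\<lambda>y. ennreal c * indicator (ball x R) y) \<in> borel_measurable borel" for c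
    by measurable
  have pt: "ennreal (1 / dist x y) * indicator (ball x R) y
      \<le> ennreal (1 / R) * indicator (ball x R) y + (\<integral>\<^sup>+s. ?F y s \<partial>lborel)" for y
  \<comment> \<open>For \<open>x = y\<close> the left side is 0 because
    \<open>1 / 0 = 0\<close>.\<close>
  proof (cases "x \<noteq> y \<and> dist x y < R")
    case True
    define d where "d = dist x y"
    have d: "0 < d" "d < R" using True by (auto simp: d_def)
    have "(\<integral>\<^sup>+s. ?F y s \<partial>lborel) = (\<integral>\<^sup>+s. ennreal (1 / s\<^sup>2) * indicator {d..R} s \<partial>lborel)"
      using d by (intro nn_integral_cong) (auto simp: indicator_def d_def[symmetric])
    also have "\<dots> = ennreal ((- 1 / R) - (- 1 / d))"
    proof (rule nn_integral_FTC_Icc)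
      fix s assume "s \<in> {d..R}"
      then have "s > 0" using d by simp
      then show "((\<lambda>s. - 1 / s) has_real_derivative 1 / s\<^sup>2) (at s)"
        by (auto intro!: derivative_eq_intros simp:
            power2_eq_square)
    qed (use d in auto)
    finally have "(\<integral>\<^sup>+s. ?F y s \<partial>lborel) = ennreal (1 / d - 1 / R)" by simp
    then show ?thesis using d R
      by (simp add: d_def[symmetric] ennreal_plus[symmetric] frac_le del: ennreal_plus)
  qed auto
  have "(\<integral>\<^sup>+y. ennreal (1 / dist x y) * indicator (ball x R) y \<partial>lborel)
      \<le> (\<integral>\<^sup>+y. ennreal (1 / R) * indicator (ball x R) y + (\<integral>\<^sup>+s. ?F y s \<partial>lborel) \<partial>lborel)"
    by (intro nn_integral_mono pt)
  also have "\<dots> = ennreal (pi * R) + (\<integral>\<^sup>+y. \<integral>\<^sup>+s. ?F y s \<partial>lborel \<partial>lborel)"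
    using R by (subst nn_integral_add)
      (auto simp: mb nn_integral_cmult_indicator emeasure_ball_plane ennreal_mult[symmetric] power2_eq_square)
  also have "(\<integral>\<^sup>+y. \<integral>\<^sup>+s. ?F y s \<partial>lborel \<partial>lborel) = (\<integral>\<^sup>+s. \<integral>\<^sup>+y. ?F y s \<partial>lborel \<partial>lborel)"
    by (rule lborel_pair.Fubini'[symmetric]) measurable
  also have "\<dots> \<le> (\<integral>\<^sup>+s. ennreal pi * indicator {0<..R} s \<partial>lborel)"
  proof (intro nn_integral_mono)
    fix s :: real
    show "(\<integral>\<^sup>+y. ?F y s \<partial>lborel) \<le> ennreal pi * indicator {0<..R} s"
    proof (cases "0 < s \<and> s \<le> R")
      case True
      then have "(\<integral>\<^sup>+y. ?F y s \<partial>lborel) = (\<integral>\<^sup>+y. ennreal (1 / s\<^sup>2) * indicator (cball x s) y \<partial>lborel)"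
        by (intro nn_integral_cong) (auto simp: indicator_def)
      also have "\<dots> = ennreal pi"
        using True by (simp add: nn_integral_cmult_indicator emeasure_cball_plane ennreal_mult[symmetric])
      finally show ?thesis using True by simp
    qed auto
  qed
  also have "\<dots> = ennreal (pi * R)"
    using R by (simp add: nn_integral_cmult_indicator ennreal_mult[symmetric])
  finally show ?thesis
    using R by (simp add: ennreal_plus[symmetric] add_left_mono algebra_simps del: ennreal_plus)
qed

text \<open>The same device, with \<open>2 / s ^ 3\<close> as integrand. The disks are counted
  together with the hole \<open>ball x r\<close>; this costs the summand \<open>pi\<close>, which
  only enters the additive constant of the capacity estimate.\<close>

lemma nn_integral_inverse_dist_sq_annulus:
  fixes x :: "real^2"
  assumes r: "0 < r" "r \<le> R"
  shows "(\<integral>\<^sup>+y. ennreal (1 / (dist x y)\<^sup>2) * indicator (ball x R - ball x r) y \<partial>lborel)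
    \<le> ennreal (pi + 2 * pi * ln (R / r))"
proof -
  let ?F = "\<lambda>y s. indicator {(y, s). dist x y \<le> s} (y, s) * ennreal (2 / s ^ 3) * indicator {r..R} s :: ennreal"
  have mb: "(\<lambda>y. ennreal c * indicator (ball x R) y) \<in> borel_measurable borel" for c
    by measurable
  have pt: "ennreal (1 / (dist x y)\<^sup>2) * indicator (ball x R - ball x r) y
      \<le> ennreal (1 / R\<^sup>2) * indicator (ball x R) y + (\<integral>\<^sup>+s. ?F y s \<partial>lborel)" for y
  proof (cases "r \<le> dist x y \<and> dist x y < R")
    case True
    define d where "d = dist x y"
    have d: "r \<le> d" "0 < d" "d < R" using True r by (auto simp: d_def intro: less_le_trans)
    have "(\<integral>\<^sup>+s. ?F y s \<partial>lborel) = (\<integral>\<^sup>+s. ennreal (2 / s ^ 3) * indicator {d..R} s \<partial>lborel)"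
      using d by (intro nn_integral_cong) (auto simp: indicator_def d_def[symmetric])
    also have "\<dots> = ennreal ((- 1 / R\<^sup>2) - (- 1 / d\<^sup>2))"
    proof (rule nn_integral_FTC_Icc)
      fix s assume "s \<in> {d..R}"
      then have "s > 0" using d by simp
      then show "((\<lambda>s. - 1 / s\<^sup>2) has_real_derivative 2 / s ^ 3) (at s)"
        by (auto intro!: derivative_eq_intros simp:
            power2_eq_square power3_eq_cube field_simps)
    qed (use d in auto)
    finally have "(\<integral>\<^sup>+s. ?F y s \<partial>lborel) = ennreal (1 / d\<^sup>2 - 1 / R\<^sup>2)" by simp
    then show ?thesis using d r
      by (simp add: d_def[symmetric] ennreal_plus[symmetric] frac_le power_mono del: ennreal_plus)
  qed auto
  have "(\<integral>\<^sup>+y. ennreal (1 / (dist x y)\<^sup>2) * indicator (ball x R - ball x r) y \<partial>lborel)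
      \<le> (\<integral>\<^sup>+y. ennreal (1 / R\<^sup>2) * indicator (ball x R) y + (\<integral>\<^sup>+s. ?F y s \<partial>lborel) \<partial>lborel)"
    by (intro nn_integral_mono pt)
  also have "\<dots> = ennreal pi + (\<integral>\<^sup>+y. \<integral>\<^sup>+s. ?F y s \<partial>lborel \<partial>lborel)"
    using r by (subst nn_integral_add)
      (auto simp: mb nn_integral_cmult_indicator emeasure_ball_plane ennreal_mult[symmetric])
  also have "(\<integral>\<^sup>+y. \<integral>\<^sup>+s. ?F y s \<partial>lborel \<partial>lborel) = (\<integral>\<^sup>+s. \<integral>\<^sup>+y. ?F y s \<partial>lborel \<partial>lborel)"
    by (rule lborel_pair.Fubini'[symmetric]) measurable
  also have "\<dots> \<le> (\<integral>\<^sup>+s. ennreal (2 * pi / s) * indicator {r..R} s \<partial>lborel)"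
  proof (intro nn_integral_mono)
    fix s :: real
    show "(\<integral>\<^sup>+y. ?F y s \<partial>lborel) \<le> ennreal (2 * pi / s) * indicator {r..R} s"
    proof (cases "r \<le> s \<and> s \<le> R")
      case True
      then have "s > 0" using r by linarith
      have "(\<integral>\<^sup>+y. ?F y s \<partial>lborel) = (\<integral>\<^sup>+y. ennreal (2 / s ^ 3) * indicator (cball x s) y \<partial>lborel)"
        using True by (intro nn_integral_cong) (auto simp: indicator_def)
      also have "\<dots> = ennreal (2 * pi / s)"
        using \<open>s > 0\<close> by (simp add: nn_integral_cmult_indicator emeasure_cball_plane ennreal_mult[symmetric]
            power2_eq_square power3_eq_cube)
      finally show ?thesis using True by simp
    qed auto
  qed
  also have "\<dots> = ennreal (2 * pi * ln R - 2 * pi * ln r)"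
  proof (rule nn_integral_FTC_Icc)
    fix s assume "s \<in> {r..R}"
    then have "s > 0" using r by auto
    then show "((\<lambda>s. 2 * pi * ln s) has_real_derivative 2 * pi / s) (at s)"
      by (auto intro!: derivative_eq_intros)
  qed (use r in auto)
  also have "2 * pi * ln R - 2 * pi * ln r = 2 * pi * ln (R / r)"
    using r by (simp add: ln_div algebra_simps)
  finally show ?thesis
    using r by (simp add: ennreal_plus[symmetric] del: ennreal_plus)
qed

subsection \<open>Truncated oscillation along paths\<close>

text \<open>Take the last time at which \<open>f \<ge> c\<close>, then the first later time at which
  \<open>f \<le> d\<close>. Strictly in between the path stays in the open slab, so the whole drop
  from \<open>c\<close> to \<open>d\<close> happens there.\<close>

lemma crossing_interval:
  fixes f :: "real \<Rightarrow> real"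
  assumes cont: "continuous_on {0..1} f" and "c \<le> f 0" "f 1 \<le> d" "d < c"
  obtains \<alpha> \<beta> where "0 \<le> \<alpha>" "\<alpha> < \<beta>" "\<beta> \<le> 1" "f \<alpha> = c" "f \<beta> = d"
    "\<And>r. \<alpha> < r \<Longrightarrow> r < \<beta> \<Longrightarrow> d < f r \<and> f r < c"
proof -
  let ?S = "{r \<in> {0..1}. c \<le> f r}"
  define \<alpha> where "\<alpha> = Sup ?S"
  have cl: "closed ?S"
    using continuous_closed_preimage[OF cont, of "{c..}"] by (simp add: vimage_def Int_def)
  have "0 \<in> ?S" using assms by simp
  then have ne: "?S \<noteq> {}" by blast
  have bd: "bdd_above ?S" by (auto intro: bdd_aboveI[of _ 1])
  have \<alpha>: "\<alpha> \<in> ?S" unfolding \<alpha>_def using closed_contains_Sup[OF ne bd cl] .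
  have after: "f r < c" if "\<alpha> < r" "r \<le> 1" for r
  proof (rule ccontr)
    assume "\<not> f r < c"
    then have "r \<in> ?S" using that \<alpha> by auto
    then show False using cSup_upper[OF _ bd] that unfolding \<alpha>_def by fastforce
  qed
  have \<alpha>1: "\<alpha> < 1" using \<alpha> assms by (cases "\<alpha> = 1") auto
  have fa: "f \<alpha> = c"
  proof (rule ccontr)
    assume "f \<alpha> \<noteq> c"
    then have gt: "f \<alpha> > c" using \<alpha> by auto
    have "\<exists>x\<ge>\<alpha>. x \<le> 1 \<and> f x = c"
      by (rule IVT2') (use gt assms \<alpha> \<alpha>1 in \<open>auto intro: continuous_on_subset[OF cont]\<close>)
    then obtain x where "\<alpha> \<le> x" "x \<le> 1" "f x = c" by blast
    then show False using after[of x] gt by (cases "x = \<alpha>") auto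
  qed
  let ?T = "{r \<in> {\<alpha>..1}. f r \<le> d}"
  have cont2: "continuous_on {\<alpha>..1} f" using \<alpha> by (auto intro: continuous_on_subset[OF cont])
  define \<beta> where "\<beta> = Inf ?T"
  have cl2: "closed ?T"
    using continuous_closed_preimage[OF cont2, of "{..d}"] by (simp add: vimage_def Int_def)
  have ne2: "?T \<noteq> {}" and bd2: "bdd_below ?T" using assms \<alpha>1 by (auto intro: bdd_belowI[of _ \<alpha>])
  have \<beta>: "\<beta> \<in> ?T" unfolding \<beta>_def using closed_contains_Inf[OF ne2 bd2 cl2] .
  have before: "d < f r" if "\<alpha> \<le> r" "r < \<beta>" for r
  proof (rule ccontr)
    assume "\<not> d < f r"
    then have "r \<in> ?T" using that \<beta> by auto
    then show False using cInf_lower[OF _ bd2] that unfolding \<beta>_def by fastforce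
  qed
  have ab: "\<alpha> < \<beta>" using \<beta> fa assms by (cases "\<alpha> = \<beta>") auto
  have fb: "f \<beta> = d"
  proof (rule ccontr)
    assume "f \<beta> \<noteq> d"
    then have lt: "f \<beta> < d" using \<beta> by auto
    have "\<exists>x\<ge>\<alpha>. x \<le> \<beta> \<and> f x = d"
      by (rule IVT2') (use lt assms fa ab \<beta> in \<open>auto intro: continuous_on_subset[OF cont2]\<close>)
    then obtain x where "\<alpha> \<le> x" "x \<le> \<beta>" "f x = d" by blast
    then show False using before[of x] lt by (cases "x = \<beta>") auto
  qed
  show thesis
    by (rule that[of \<alpha> \<beta>]) (use \<alpha> \<beta> ab fa fb before after in auto)
qed

text \<open>The truncated function need not be differentiable. On a crossing interval between its
  two end values the truncation is inactive, and the fundamental theorem of calculus applies to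
  \<open>f\<close> itself. An increase needs no argument, since the left side is then 0.\<close>

lemma clamp_diff_le:
  fixes f f' :: "real \<Rightarrow> real"
  assumes der: "\<And>r. 0 \<le> r \<Longrightarrow> r \<le> 1 \<Longrightarrow> (f has_real_derivative f' r) (at r)"
    and cont': "continuous_on {0..1} f'" and "s \<le> t"
  shows "ennreal (max s (min t (f 0)) - max s (min t (f 1)))
    \<le> (\<integral>\<^sup>+r. indicator {0..1} r * (indicator {r. s < f r \<and> f r < t} r * ennreal \<bar>f' r\<bar>) \<partial>lborel)"
proof -
  let ?c = "max s (min t (f 0))" and ?d = "max s (min t (f 1))"
  show ?thesis
  proof (cases "?d < ?c")
    case True
    have cont: "continuous_on {0..1} f"
      using der by (auto intro!: continuous_at_imp_continuous_on DERIV_isCont)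
    have "?c \<le> f 0" "f 1 \<le> ?d" using True assms(3) by (auto simp: max_def min_def split: if_splits)
    then obtain \<alpha> \<beta> where ab: "0 \<le> \<alpha>" "\<alpha> < \<beta>" "\<beta> \<le> 1" and fa: "f \<alpha> = ?c" and fb: "f \<beta> = ?d"
      and mid: "\<And>r. \<alpha> < r \<Longrightarrow> r < \<beta> \<Longrightarrow> ?d < f r \<and> f r < ?c"
      using crossing_interval[OF cont] True by metis
    have hb: "has_bochner_integral lborel (\<lambda>r. indicator {\<alpha>..\<beta>} r *\<^sub>R f' r) (f \<beta> - f \<alpha>)"
    proof (rule has_bochner_integral_FTC_Icc)
      show "continuous_on {\<alpha>..\<beta>} f'" using ab by (auto intro: continuous_on_subset[OF cont'])
      fix x assume "\<alpha> \<le> x" "x \<le> \<beta>"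
      then show "(f has_vector_derivative f' x) (at x within {\<alpha>..\<beta>})"
        using der[of x] ab by (auto simp: has_real_derivative_iff_has_vector_derivative[symmetric]
            intro: has_field_derivative_at_within)
    qed (use ab in auto)
    have "ennreal (?c - ?d) \<le> ennreal (norm (f \<beta> - f \<alpha>))" 
      unfolding fa fb by (intro ennreal_leI) (use abs_ge_minus_self[of "?d - ?c"] in simp)
    also have "\<dots> \<le> (\<integral>\<^sup>+r. norm (indicator {\<alpha>..\<beta>} r *\<^sub>R f' r) \<partial>lborel)"
      using integral_norm_bound_ennreal[OF integrable.intros[OF hb]]
        has_bochner_integral_integral_eq[OF hb] by simp
    also have "\<dots> \<le> (\<integral>\<^sup>+r. indicator {0..1} r * (indicator {r. s < f r \<and> f r < t} r * ennreal \<bar>f' r\<bar>) \<partial>lborel)"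
    proof (rule nn_integral_mono_AE)
      \<comment> \<open>At the end points \<open>f\<close> may equal \<open>s\<close> or
        \<open>t\<close>, which the open slab excludes.\<close>
      have "AE r in lborel. r \<noteq> \<alpha> \<and> r \<noteq> \<beta>"
        using AE_lborel_singleton[of \<alpha>] AE_lborel_singleton[of \<beta>] by eventually_elim auto
      then show "AE r in lborel. ennreal (norm (indicator {\<alpha>..\<beta>} r *\<^sub>R f' r))
        \<le> indicator {0..1} r * (indicator {r. s < f r \<and> f r < t} r * ennreal \<bar>f' r\<bar>)"
      proof eventually_elim
        case (elim r)
        have "s \<le> ?d" "?c \<le> t" using assms(3) by auto
        show ?case
        proof (cases "\<alpha> < r \<and> r < \<beta>")
          case True
          then have "?d < f r" "f r < ?c" using mid[of r] by auto
          then have "s < f r" "f r < t" using \<open>s \<le> ?d\<close> \<open>?c \<le> t\<close> by linarith+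
          then show ?thesis using True ab by auto
        qed (use elim in auto)
      qed
    qed
    finally show ?thesis .
  next
    case False
    have "ennreal (?c - ?d) = 0" by (rule ennreal_neg) (use False in linarith)
    then show ?thesis by (simp only: zero_le)
  qed
qed

text \<open>The gradient is a parameter so that the results also apply to a composition
  \<open>H (f x)\<close>, as needed for the superlevel sets. The support radius below 1 keeps the
  weight bounded on the support.\<close>

locale C1_disk =
  fixes f :: "real^2 \<Rightarrow> real" and G :: "real^2 \<Rightarrow> real^2" and R :: real
  assumes deriv: "\<And>x. (f has_derivative (\<lambda>h. G x \<bullet> h)) (at x)"
    and contG: "continuous_on UNIV G"
    and R: "0 < R" "R < 1" and supp: "\<And>x. R \<le> norm x \<Longrightarrow> f x = 0"
begin

lemma cont: "continuous_on UNIV f"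
  by (intro continuous_at_imp_continuous_on ballI has_derivative_continuous[OF deriv])

lemma measurable_f [measurable]: "f \<in> borel_measurable borel"
  using cont borel_measurable_continuous_onI by blast

lemma measurable_G [measurable]: "G \<in> borel_measurable borel"
  using contG borel_measurable_continuous_onI by blast

definition slab :: "real \<Rightarrow> real \<Rightarrow> real^2 \<Rightarrow> ennreal" where
  "slab s t x = indicator {x. s < f x \<and> f x < t} x * ennreal (norm (G x))"

lemma measurable_slab [measurable]: "slab s t \<in> borel_measurable borel"
  unfolding slab_def by measurable

lemma clamp_segment:
  assumes "s \<le> t"
  shows "ennreal (max s (min t (f p)) - max s (min t (f (p + v))))
    \<le> ennreal (norm v) * (\<integral>\<^sup>+r. indicator {0..1} r * slab s t (p + r *\<^sub>R v) \<partial>lborel)"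
proof -
  let ?h = "\<lambda>r::real. f (p + r *\<^sub>R v)" and ?h' = "\<lambda>r. G (p + r *\<^sub>R v) \<bullet> v"
  have der: "(?h has_real_derivative ?h' r) (at r)" for r
    unfolding has_field_derivative_def
    by (rule has_derivative_eq_rhs, rule has_derivative_compose[OF _ deriv], (rule derivative_intros)+)
       (auto simp: mult.commute)
  have "ennreal (max s (min t (?h 0)) - max s (min t (?h 1)))
    \<le> (\<integral>\<^sup>+r. indicator {0..1} r * (indicator {r. s < ?h r \<and> ?h r < t} r * ennreal \<bar>?h' r\<bar>) \<partial>lborel)"
    by (intro clamp_diff_le der assms continuous_intros continuous_on_compose2[OF contG]) auto
  also have "\<dots> \<le> (\<integral>\<^sup>+r. ennreal (norm v) * (indicator {0..1} r * slab s t (p + r *\<^sub>R v)) \<partial>lborel)"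
    by (intro nn_integral_mono)
      (auto simp: slab_def indicator_def ennreal_mult[symmetric] intro!: ennreal_leI
        order_trans[OF Cauchy_Schwarz_ineq2])
  finally show ?thesis by (simp add: nn_integral_cmult)
qed

text \<open>From \<open>x\<close> one reaches a zero of \<open>f\<close> outside the disk by going to a point \<open>x + w\<close> of the ball
  around \<open>x\<close> of half the distance to the boundary, and then outwards along a fixed direction.
  Averaging over \<open>w\<close> makes the kernel of the first leg the one of the logarithmic potential,
  while the kernel of the second leg is bounded in \<open>L\<^sup>2\<close>.\<close>

lemma clamp_path:
  assumes "0 \<le> s" "s \<le> t" "norm x < 1" "t \<le> f x" "norm e = 1" "x = norm x *\<^sub>R e"
    and w: "norm w < (1 - norm x) / 2"
  shows "ennreal (t - s) \<le>
     (\<integral>\<^sup>+r. indicator {0..1} r * (ennreal (norm w) * slab s t (x + r *\<^sub>R w)) \<partial>lborel)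
     + ennreal (2 * (1 - norm x)) *
       (\<integral>\<^sup>+r. indicator {0..1} r * slab s t (x + w + (2 * r * (1 - norm x)) *\<^sub>R e) \<partial>lborel)"
proof -
  let ?d = "1 - norm x" let ?v = "(2 * ?d) *\<^sub>R e" and ?c = "\<lambda>z. max s (min t (f z))"
  \<comment> \<open>Along \<open>e\<close> the point \<open>x\<close> and the second leg have
    components \<open>norm x\<close> and \<open>2 * (1 - norm x)\<close>, and \<open>w\<close> takes
    away less than \<open>(1 - norm x) / 2\<close>. So the path ends outside the disk, where
    \<open>f\<close> is 0 and its truncation is \<open>s\<close>.\<close>
  have "1 \<le> (x + w + ?v) \<bullet> e"
  proof -
    have "e \<bullet> e = 1" using assms(5) by (simp add: dot_square_norm)
    then have "x \<bullet> e = norm x" by (subst assms(6)) simp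
    moreover have "\<bar>w \<bullet> e\<bar> \<le> norm w" using Cauchy_Schwarz_ineq2[of w e] assms(5) by simp
    ultimately show ?thesis using w \<open>e \<bullet> e = 1\<close> by (simp add: inner_add_left)
  qed
  also have "\<dots> \<le> norm (x + w + ?v)"
    using Cauchy_Schwarz_ineq2[of "x + w + ?v" e] assms(5) by simp
  finally have "f (x + w + ?v) = 0" using supp R by simp
  then have "ennreal (t - s) = ennreal ((?c x - ?c (x + w)) + (?c (x + w) - ?c (x + w + ?v)))"
    using assms by (simp add: max_def min_def)
  also have "\<dots> \<le> ennreal (?c x - ?c (x + w)) + ennreal (?c (x + w) - ?c (x + w + ?v))"
    by (rule ennreal_add_le)
  also have "\<dots> \<le> ennreal (norm w) * (\<integral>\<^sup>+r. indicator {0..1} r * slab s t (x + r *\<^sub>R w) \<partial>lborel)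
    + ennreal (norm ?v) * (\<integral>\<^sup>+r. indicator {0..1} r * slab s t (x + w + r *\<^sub>R ?v) \<partial>lborel)"
    by (intro add_mono clamp_segment assms)
  also have "ennreal (norm w) * (\<integral>\<^sup>+r. indicator {0..1} r * slab s t (x + r *\<^sub>R w) \<partial>lborel)
    = (\<integral>\<^sup>+r. indicator {0..1} r * (ennreal (norm w) * slab s t (x + r *\<^sub>R w)) \<partial>lborel)"
    by (subst nn_integral_cmult[symmetric]) (auto simp: mult_ac)
  finally show ?thesis using assms by (simp add: mult_ac)
qed

end

text \<open>For fixed \<open>r\<close> substitute \<open>y = r *\<^sub>R w\<close>: the volume
  factor \<open>1 / r\<^sup>2\<close> and \<open>norm w = norm y / r\<close> give the weight
  \<open>norm y / r ^ 3\<close> on \<open>norm y < r * \<rho>\<close>. Integration over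
  \<open>r\<close> between \<open>norm y / \<rho>\<close> and 1 leaves at most
  \<open>\<rho>\<^sup>2 / (2 * norm y)\<close>.\<close>

lemma average_first_leg:
  fixes g :: "real^2 \<Rightarrow> ennreal"
  assumes [measurable]: "g \<in> borel_measurable borel" and \<rho>: "\<rho> > 0"
  shows "(\<integral>\<^sup>+w. indicator (ball 0 \<rho>) w *
      (\<integral>\<^sup>+r. indicator {0..1} r * (ennreal (norm w) * g (x + r *\<^sub>R w)) \<partial>lborel) \<partial>lborel)
    \<le> ennreal (\<rho>\<^sup>2 / 2) * (\<integral>\<^sup>+y. indicator (ball x \<rho>) y * ennreal (1 / dist x y) * g y \<partial>lborel)"
    (is "?L \<le> _")
proof -
  let ?K = "\<lambda>y r. indicator {(y::real^2, r). norm y < r * \<rho>} (y, r) * indicator {0<..1} r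
    * ennreal (norm y / r ^ 3) * g (x + y) :: ennreal"
  have "?L = (\<integral>\<^sup>+w. \<integral>\<^sup>+r. indicator (ball 0 \<rho>) w * (indicator {0..1} r * (ennreal (norm w) * g (x + r *\<^sub>R w))) \<partial>lborel \<partial>lborel)"
    by (simp add: nn_integral_cmult)
  also have "\<dots> = (\<integral>\<^sup>+r. \<integral>\<^sup>+w. indicator (ball 0 \<rho>) w * (indicator {0..1} r * (ennreal (norm w) * g (x + r *\<^sub>R w))) \<partial>lborel \<partial>lborel)"
    by (rule lborel_pair.Fubini'[symmetric]) measurable
  also have "\<dots> = (\<integral>\<^sup>+r. \<integral>\<^sup>+y. ?K y r \<partial>lborel \<partial>lborel)"
  proof (rule nn_integral_cong_AE)
    \<comment> \<open>The substitution degenerates at \<open>r = 0\<close>.\<close>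
    show "AE r in lborel. (\<integral>\<^sup>+w. indicator (ball 0 \<rho>) w * (indicator {0..1} r * (ennreal (norm w) * g (x + r *\<^sub>R w))) \<partial>lborel)
      = (\<integral>\<^sup>+y. ?K y r \<partial>lborel)"
      using AE_lborel_singleton[of "0::real"]
    proof eventually_elim
      case (elim r)
      show ?case
      proof (cases "0 < r \<and> r \<le> 1")
        case True
        then have "(\<integral>\<^sup>+y. ?K y r \<partial>lborel) = ennreal (r ^ 2) * (\<integral>\<^sup>+w. ?K (r *\<^sub>R w) r \<partial>lborel)"
          by (subst nn_integral_affine[of _ r 0]) (auto)
        also have "\<dots> = (\<integral>\<^sup>+w. ennreal (r ^ 2) * ?K (r *\<^sub>R w) r \<partial>lborel)"
          by (rule nn_integral_cmult[symmetric]) measurable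
        also have "\<dots> = (\<integral>\<^sup>+w. indicator (ball 0 \<rho>) w * (indicator {0..1} r * (ennreal (norm w) * g (x + r *\<^sub>R w))) \<partial>lborel)"
        proof (intro nn_integral_cong)
          fix w :: "real^2"
          have "ennreal (r\<^sup>2) * ennreal (norm (r *\<^sub>R w) / r ^ 3) = ennreal (norm w)"
            using True by (simp add: ennreal_mult[symmetric] power2_eq_square power3_eq_cube)
          then have "ennreal (r\<^sup>2) * (ennreal (norm (r *\<^sub>R w) / r ^ 3) * z) = ennreal (norm w) * z" for z
            by (simp add: mult.assoc[symmetric])
          then show "ennreal (r ^ 2) * ?K (r *\<^sub>R w) r =
            indicator (ball 0 \<rho>) w * (indicator {0..1} r * (ennreal (norm w) * g (x + r *\<^sub>R w)))"
            using True by (auto simp: indicator_def)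
        qed
        finally show ?thesis by simp
      qed (use elim in auto)
    qed
  qed
  also have "\<dots> = (\<integral>\<^sup>+y. \<integral>\<^sup>+r. ?K y r \<partial>lborel \<partial>lborel)"
    by (rule lborel_pair.Fubini') measurable
  also have "\<dots> \<le> (\<integral>\<^sup>+y. ennreal (\<rho>\<^sup>2 / 2) * (indicator (ball 0 \<rho>) y * ennreal (1 / norm y) * g (x + y)) \<partial>lborel)"
  proof (intro nn_integral_mono)
    fix y :: "real^2"
    show "(\<integral>\<^sup>+r. ?K y r \<partial>lborel) \<le> ennreal (\<rho>\<^sup>2 / 2) * (indicator (ball 0 \<rho>) y * ennreal (1 / norm y) * g (x + y))"
    proof (cases "y \<noteq> 0 \<and> norm y < \<rho>")
      case True
      define q where "q = norm y / \<rho>"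
      have q: "0 < q" "q < 1" using True \<rho> by (auto simp: q_def)
      have "(\<integral>\<^sup>+r. ?K y r \<partial>lborel) \<le> (\<integral>\<^sup>+r. ennreal (norm y) * g (x + y) * (ennreal (1 / r ^ 3) * indicator {q..1} r) \<partial>lborel)"
      proof (intro nn_integral_mono)
        fix r :: real
        show "?K y r \<le> ennreal (norm y) * g (x + y) * (ennreal (1 / r ^ 3) * indicator {q..1} r)"
        proof (cases "norm y < r * \<rho> \<and> 0 < r \<and> r \<le> 1")
          case True
          then have "q \<le> r" using \<rho> by (simp add: q_def pos_divide_le_eq)
          moreover have "ennreal (norm y / r ^ 3) = ennreal (norm y) * ennreal (1 / r ^ 3)"
            using True by (simp add: ennreal_mult[symmetric])
          ultimately show ?thesis using True by (simp add: mult_ac)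
        qed (auto simp: indicator_def)
      qed
      also have "\<dots> = ennreal (norm y) * g (x + y) * (\<integral>\<^sup>+r. ennreal (1 / r ^ 3) * indicator {q..1} r \<partial>lborel)"
        by (rule nn_integral_cmult) measurable
      also have "(\<integral>\<^sup>+r. ennreal (1 / r ^ 3) * indicator {q..1} r \<partial>lborel) = ennreal (- 1 / (2 * 1\<^sup>2) - - 1 / (2 * q\<^sup>2))"
      proof (rule nn_integral_FTC_Icc)
        fix r assume "r \<in> {q..1}"
        then have "r > 0" using q by simp
        then show "((\<lambda>r. - 1 / (2 * r\<^sup>2)) has_real_derivative 1 / r ^ 3) (at r)"
          by (auto intro!: derivative_eq_intros simp: power2_eq_square power3_eq_cube field_simps)
      qed (use q in auto)
      also have "\<dots> \<le> ennreal (\<rho>\<^sup>2 / 2 * (1 / norm y) * (1 / norm y))"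
        using True by (intro ennreal_leI) (simp add: q_def power2_eq_square)
      finally have "(\<integral>\<^sup>+r. ?K y r \<partial>lborel) \<le> ennreal (norm y) * g (x + y) * ennreal (\<rho>\<^sup>2 / 2 * (1 / norm y) * (1 / norm y))"
        by (simp add: mult_left_mono)
      also have "\<dots> = (ennreal (norm y) * ennreal (\<rho>\<^sup>2 / 2 * (1 / norm y) * (1 / norm y))) * g (x + y)"
        by (simp add: mult_ac)
      also have "ennreal (norm y) * ennreal (\<rho>\<^sup>2 / 2 * (1 / norm y) * (1 / norm y)) = ennreal (\<rho>\<^sup>2 / 2) * ennreal (1 / norm y)"
        using True by (simp add: ennreal_mult[symmetric])
      finally show ?thesis using True by (simp add: mult_ac)
    next
      case False
      have "?K y r = 0" for r
      proof (cases "y = 0")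
        case False
        then have "\<rho> \<le> norm y" using \<open>\<not> (y \<noteq> 0 \<and> norm y < \<rho>)\<close> by simp
        moreover have "r * \<rho> \<le> \<rho>" if "r \<le> 1" using that \<rho> by simp
        ultimately show ?thesis by (auto simp: indicator_def)
      qed simp
      then have "(\<integral>\<^sup>+r. ?K y r \<partial>lborel) = (\<integral>\<^sup>+(r::real). 0 \<partial>lborel)" by (intro nn_integral_cong)
      then show ?thesis by (simp only: nn_integral_const mult_zero_left zero_le)
    qed
  qed
  also have "\<dots> = (\<integral>\<^sup>+y. ennreal (\<rho>\<^sup>2 / 2) * (indicator (ball x \<rho>) (x + y) * ennreal (1 / dist x (x + y)) * g (x + y)) \<partial>lborel)"
    by (intro nn_integral_cong) (simp add: indicator_def dist_norm)
  also have "\<dots> = (\<integral>\<^sup>+y. ennreal (\<rho>\<^sup>2 / 2) * (indicator (ball x \<rho>) y * ennreal (1 / dist x y) * g y) \<partial>lborel)"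
    by (rule nn_integral_translate) measurable
  finally show ?thesis by (subst (asm) nn_integral_cmult) auto
qed

text \<open>For each \<open>r\<close> the points \<open>w\<close> are only translated, by a vector
  of norm at most \<open>2 * d\<close>. Hence no singular kernel arises, and with
  \<open>norm w < d / 2\<close> all points stay in \<open>ball x (3 * d)\<close>.\<close>

lemma average_second_leg:
  fixes g :: "real^2 \<Rightarrow> ennreal"
  assumes [measurable]: "g \<in> borel_measurable borel" and d: "d > 0" and e: "norm e = 1"
  shows "(\<integral>\<^sup>+w. indicator (ball 0 (d / 2)) w *
      (\<integral>\<^sup>+r. indicator {0..1} r * g (x + w + (2 * r * d) *\<^sub>R e) \<partial>lborel) \<partial>lborel)
    \<le> (\<integral>\<^sup>+y. indicator (ball x (3 * d)) y * g y \<partial>lborel)" (is "?L \<le> ?J")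
proof -
  have "?L = (\<integral>\<^sup>+w. \<integral>\<^sup>+r. indicator (ball 0 (d / 2)) w * (indicator {0..1} r * g (x + w + (2 * r * d) *\<^sub>R e)) \<partial>lborel \<partial>lborel)"
    by (simp add: nn_integral_cmult)
  also have "\<dots> = (\<integral>\<^sup>+r. \<integral>\<^sup>+w. indicator (ball 0 (d / 2)) w * (indicator {0..1} r * g (x + w + (2 * r * d) *\<^sub>R e)) \<partial>lborel \<partial>lborel)"
    by (rule lborel_pair.Fubini'[symmetric]) measurable
  also have "\<dots> \<le> (\<integral>\<^sup>+r. ?J * indicator {0..1::real} r \<partial>lborel)"
  proof (intro nn_integral_mono)
    fix r :: real
    show "(\<integral>\<^sup>+w. indicator (ball 0 (d / 2)) w * (indicator {0..1} r * g (x + w + (2 * r * d) *\<^sub>R e)) \<partial>lborel) \<le> ?J * indicator {0..1} r"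
    proof (cases "0 \<le> r \<and> r \<le> 1")
      case True
      have "(\<integral>\<^sup>+w. indicator (ball 0 (d / 2)) w * (indicator {0..1} r * g (x + w + (2 * r * d) *\<^sub>R e)) \<partial>lborel)
        \<le> (\<integral>\<^sup>+w. indicator (ball x (3 * d)) (x + (2 * r * d) *\<^sub>R e + w) * g (x + (2 * r * d) *\<^sub>R e + w) \<partial>lborel)"
      proof (intro nn_integral_mono)
        fix w
        have "dist x (x + (2 * r * d) *\<^sub>R e + w) < 3 * d" if "norm w < d / 2"
        proof -
          have "norm ((2 * r * d) *\<^sub>R e + w) \<le> 2 * (r * d) + norm w"
            using norm_triangle_ineq[of "(2 * r * d) *\<^sub>R e" w] True d e by simp
          moreover have "r * d \<le> d" using True d by simp
          ultimately have "norm ((2 * r * d) *\<^sub>R e + w) < 3 * d" using that d by linarith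
          then show ?thesis by (subst dist_commute) (simp add: dist_norm add.assoc)
        qed
        then show "indicator (ball 0 (d / 2)) w * (indicator {0..1} r * g (x + w + (2 * r * d) *\<^sub>R e))
          \<le> indicator (ball x (3 * d)) (x + (2 * r * d) *\<^sub>R e + w) * g (x + (2 * r * d) *\<^sub>R e + w)"
          by (auto simp: indicator_def ac_simps)
      qed
      also have "\<dots> = ?J"
        by (rule nn_integral_translate[of "\<lambda>z. indicator (ball x (3 * d)) z * g z"]) measurable
      finally show ?thesis using True by simp
    qed auto
  qed
  also have "\<dots> = ?J" by (simp add: nn_integral_cmult)
  finally show ?thesis .
qed

subsection \<open>Potential estimates\<close>

text \<open>The size of the gradient of the logarithmic potential, cut off at half the distance to
  the boundary, so that the weights at \<open>x\<close> and \<open>y\<close> stay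
  comparable.\<close>

definition ker1 :: "real^2 \<Rightarrow> real^2 \<Rightarrow> ennreal" where
  "ker1 x y = indicator (ball x ((1 - norm x) / 2)) y * ennreal (1 / dist x y)"

text \<open>The 16 comes from normalizing the first leg: averaging over the ball of radius
  \<open>(1 - norm x) / 2\<close> gives it the factor \<open>(1 - norm x)\<^sup>2 / 8\<close>, and
  the length \<open>2 * (1 - norm x)\<close> of the second leg is divided by this factor.\<close>

definition ker2 :: "real^2 \<Rightarrow> real^2 \<Rightarrow> ennreal" where
  "ker2 x y = indicator (ball x (3 * (1 - norm x))) y * ennreal (16 / (1 - norm x))"

text \<open>A quarter of the area density of the hyperbolic metric of curvature -1.\<close>

definition hyp_weight :: "real^2 \<Rightarrow> real" where
  "hyp_weight x = 1 / (1 - (norm x)\<^sup>2)\<^sup>2"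

lemma measurable_ker1 [measurable (raw)]:
  assumes [measurable]: "f \<in> borel_measurable M" "g \<in> borel_measurable M"
  shows "(\<lambda>z. ker1 (f z) (g z)) \<in> borel_measurable M"
  unfolding ker1_def by measurable

lemma measurable_ker2 [measurable (raw)]:
  assumes [measurable]: "f \<in> borel_measurable M" "g \<in> borel_measurable M"
  shows "(\<lambda>z. ker2 (f z) (g z)) \<in> borel_measurable M"
  unfolding ker2_def by measurable

lemma measurable_hyp_weight [measurable (raw)]:
  assumes [measurable]: "f \<in> borel_measurable M"
  shows "(\<lambda>z. hyp_weight (f z)) \<in> borel_measurable M"
  unfolding hyp_weight_def by measurable

lemma hyp_weight_nonneg [simp]: "0 \<le> hyp_weight x"
  by (simp add: hyp_weight_def)

text \<open>\<open>1 - (norm x)\<^sup>2\<close> is \<open>1 - norm x\<close> times a factor between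
  1 and 2. So the weight amounts to the inverse square of the distance to the boundary, and at the
  scale of that distance Euclidean estimates suffice.\<close>

lemma hyp_weight_bounds:
  assumes "norm x < 1"
  shows "hyp_weight x \<le> 1 / (1 - norm x)\<^sup>2" "1 / (4 * (1 - norm x)\<^sup>2) \<le> hyp_weight x"
proof -
  have eq: "1 - (norm x)\<^sup>2 = (1 - norm x) * (1 + norm x)" by (simp add: algebra_simps power2_eq_square)
  have p: "1 - norm x > 0" using assms by simp
  have "1 - norm x \<le> 1 - (norm x)\<^sup>2" "1 - (norm x)\<^sup>2 \<le> 2 * (1 - norm x)"
    unfolding eq using mult_left_mono[of 1 "1 + norm x" "1 - norm x"]
      mult_left_mono[of "1 + norm x" 2 "1 - norm x"] assms by auto
  then have sq: "(1 - norm x)\<^sup>2 \<le> (1 - (norm x)\<^sup>2)\<^sup>2" "(1 - (norm x)\<^sup>2)\<^sup>2 \<le> (2 * (1 - norm x))\<^sup>2"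
    using p by (intro power_mono; linarith)+
  have pos: "0 < 1 - (norm x)\<^sup>2" using p \<open>1 - norm x \<le> 1 - (norm x)\<^sup>2\<close> by linarith
  have e4: "(2 * (1 - norm x))\<^sup>2 = 4 * (1 - norm x)\<^sup>2" unfolding power_mult_distrib by simp
  show "hyp_weight x \<le> 1 / (1 - norm x)\<^sup>2"
    unfolding hyp_weight_def using p by (intro frac_le sq) auto
  show "1 / (4 * (1 - norm x)\<^sup>2) \<le> hyp_weight x"
    unfolding hyp_weight_def using pos by (intro frac_le sq(2)[unfolded e4] zero_less_power) auto
qed

section \<open>Drops bounded by potentials of the gradient\<close>

context C1_disk
begin

text \<open>The path estimate is averaged over \<open>w\<close>. The factor \<open>2 * pi\<close> is
  that of the fundamental solution of the Laplacian and must not be lost: its square, divided by the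
  \<open>pi\<close> in front of the logarithm in the square integral of the potential, is the
  \<open>4 * pi\<close> of the capacity estimate.\<close>

lemma potential_bound:
  assumes "0 \<le> s" "s \<le> t" "norm x < 1" "t \<le> f x"
  shows "ennreal (2 * pi * (t - s)) \<le> (\<integral>\<^sup>+y. (ker1 x y + ker2 x y) * slab s t y \<partial>lborel)"
proof -
  define d where "d = 1 - norm x"
  have d: "d > 0" using assms by (simp add: d_def)
  obtain e :: "real^2" where e: "norm e = 1" "x = norm x *\<^sub>R e"
  proof (cases "x = 0")
    case True
    then show ?thesis using that[of "axis 1 1"] by simp
  next
    case False
    then show ?thesis using that[of "(1 / norm x) *\<^sub>R x"] by simp
  qed
  let ?B = "\<lambda>w::real^2. indicator (ball 0 (d / 2)) w :: ennreal"
  let ?L1 = "\<lambda>w. \<integral>\<^sup>+r. indicator {0..1} r * (ennreal (norm w) * slab s t (x + r *\<^sub>R w)) \<partial>lborel"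
  let ?L2 = "\<lambda>w. \<integral>\<^sup>+r. indicator {0..1} r * slab s t (x + w + (2 * r * d) *\<^sub>R e) \<partial>lborel"
  let ?I1 = "\<integral>\<^sup>+y. indicator (ball x (d / 2)) y * ennreal (1 / dist x y) * slab s t y \<partial>lborel"
  let ?I2 = "\<integral>\<^sup>+y. indicator (ball x (3 * d)) y * slab s t y \<partial>lborel"
  have "ennreal (t - s) * ennreal (pi * (d / 2)\<^sup>2) = (\<integral>\<^sup>+w. ennreal (t - s) * ?B w \<partial>lborel)"
    using d by (simp add: nn_integral_cmult_indicator emeasure_ball_plane)
  also have "\<dots> \<le> (\<integral>\<^sup>+w. ?B w * ?L1 w + ennreal (2 * d) * (?B w * ?L2 w) \<partial>lborel)"
  proof (rule nn_integral_mono)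
    fix w :: "real^2"
    show "ennreal (t - s) * ?B w \<le> ?B w * ?L1 w + ennreal (2 * d) * (?B w * ?L2 w)"
      using clamp_path[OF assms e, of w] by (cases "norm w < d / 2") (auto simp: d_def[symmetric])
  qed
  also have "\<dots> = (\<integral>\<^sup>+w. ?B w * ?L1 w \<partial>lborel) + ennreal (2 * d) * (\<integral>\<^sup>+w. ?B w * ?L2 w \<partial>lborel)"
    by (subst nn_integral_add, measurable) (subst nn_integral_cmult, measurable)
  also have "\<dots> \<le> ennreal ((d / 2)\<^sup>2 / 2) * ?I1 + ennreal (2 * d) * ?I2"
    using d e by (intro add_mono mult_left_mono average_first_leg average_second_leg) auto
  \<comment> \<open>\<open>8 / d\<^sup>2\<close> turns the coefficient
    \<open>(d / 2)\<^sup>2 / 2\<close> of the first leg into 1 and the area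
    \<open>pi * (d / 2)\<^sup>2\<close> into \<open>2 * pi\<close>.\<close>
  finally have "ennreal (8 / d\<^sup>2) * (ennreal (t - s) * ennreal (pi * (d / 2)\<^sup>2))
      \<le> ennreal (8 / d\<^sup>2) * (ennreal ((d / 2)\<^sup>2 / 2) * ?I1 + ennreal (2 * d) * ?I2)"
    by (rule mult_left_mono) simp
  also have "ennreal (8 / d\<^sup>2) * (ennreal (t - s) * ennreal (pi * (d / 2)\<^sup>2)) = ennreal (2 * pi * (t - s))"
    using d assms by (simp add: ennreal_mult[symmetric] power2_eq_square)
  also have "ennreal (8 / d\<^sup>2) * (ennreal ((d / 2)\<^sup>2 / 2) * ?I1 + ennreal (2 * d) * ?I2)
    = (ennreal (8 / d\<^sup>2) * ennreal ((d / 2)\<^sup>2 / 2)) * ?I1 + (ennreal (8 / d\<^sup>2) * ennreal (2 * d)) * ?I2"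
    by (simp only: distrib_left mult.assoc)
  also have "ennreal (8 / d\<^sup>2) * ennreal ((d / 2)\<^sup>2 / 2) = 1"
    using d by (simp add: ennreal_mult[symmetric] power2_eq_square)
  also have "ennreal (8 / d\<^sup>2) * ennreal (2 * d) = ennreal (16 / d)"
    using d by (simp add: ennreal_mult[symmetric] power2_eq_square)
  also have "1 * ?I1 + ennreal (16 / d) * ?I2 = (\<integral>\<^sup>+y. (ker1 x y + ker2 x y) * slab s t y \<partial>lborel)"
  proof -
    have "1 * ?I1 + ennreal (16 / d) * ?I2 = ?I1
      + (\<integral>\<^sup>+y. ennreal (16 / d) * (indicator (ball x (3 * d)) y * slab s t y) \<partial>lborel)"
      by (subst nn_integral_cmult) auto
    also have "\<dots> = (\<integral>\<^sup>+y. indicator (ball x (d / 2)) y * ennreal (1 / dist x y) * slab s t y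
       + ennreal (16 / d) * (indicator (ball x (3 * d)) y * slab s t y) \<partial>lborel)"
      by (rule nn_integral_add[symmetric]) measurable
    also have "\<dots> = (\<integral>\<^sup>+y. (ker1 x y + ker2 x y) * slab s t y \<partial>lborel)"
      by (intro nn_integral_cong) (simp add: ker1_def ker2_def d_def[symmetric] distrib_left distrib_right mult_ac)
    finally show ?thesis .
  qed
  finally show ?thesis .
qed

end

text \<open>Split at the radius \<open>\<rho> = (1 - norm y) * sqrt a\<close>. Inside, the weight is
  at most \<open>9 / (4 * d\<^sup>2)\<close> and the kernel integrates to
  \<open>2 * pi * \<rho>\<close>; outside, the kernel is at most \<open>1 / \<rho>\<close> and the
  mass at most \<open>a\<close>. The radius balances the two parts.\<close>

lemma ker1_average_bound:
  assumes [measurable]: "A \<in> sets borel" and A: "A \<subseteq> ball 0 1"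
    and a: "(\<integral>\<^sup>+x. indicator A x * ennreal (hyp_weight x) \<partial>lborel) = ennreal a" "a > 0"
    and y: "norm y < 1"
  shows "(\<integral>\<^sup>+x. indicator A x * ennreal (hyp_weight x) * ker1 x y \<partial>lborel)
    \<le> ennreal (20 * sqrt a / (1 - norm y))"
proof -
  define d where "d = 1 - norm y"
  define \<rho> where "\<rho> = d * sqrt a"
  have d: "d > 0" and \<rho>: "\<rho> > 0" using y a by (auto simp: d_def \<rho>_def)
  have pt: "indicator A x * ennreal (hyp_weight x) * ker1 x y \<le>
     ennreal (9 / (4 * d\<^sup>2)) * (ennreal (1 / dist y x) * indicator (ball y \<rho>) x)
     + ennreal (1 / \<rho>) * (indicator A x * ennreal (hyp_weight x))" for x
  proof (cases "x \<in> A \<and> dist x y < (1 - norm x) / 2")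
    case True
    have nx: "norm x < 1" using True A by auto
    have "norm y \<ge> norm x - dist x y" using norm_triangle_ineq3[of x y] by (simp add: dist_norm)
    \<comment> \<open>As \<open>dist x y\<close> is below half of \<open>1 - norm x\<close>, the
      distance to the boundary grows at most by the factor 3/2 from \<open>x\<close> to
      \<open>y\<close>.\<close>
    then have "2 / 3 * d \<le> 1 - norm x" using True by (simp add: d_def)
    then have "(2 / 3 * d)\<^sup>2 \<le> (1 - norm x)\<^sup>2" using d by (intro power_mono) auto
    then have "1 / (1 - norm x)\<^sup>2 \<le> 1 / (2 / 3 * d)\<^sup>2" using d by (intro frac_le) auto
    then have "1 / (1 - norm x)\<^sup>2 \<le> 9 / (4 * d\<^sup>2)" by (simp add: power_mult_distrib power2_eq_square)
    then have w: "hyp_weight x \<le> 9 / (4 * d\<^sup>2)" using hyp_weight_bounds[OF nx] by simp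
    have lhs: "indicator A x * ennreal (hyp_weight x) * ker1 x y = ennreal (hyp_weight x * (1 / dist x y))"
      using True by (simp add: ker1_def ennreal_mult[symmetric])
    show ?thesis
    proof (cases "dist x y < \<rho>")
      case True
      have "ennreal (hyp_weight x * (1 / dist x y)) \<le> ennreal (9 / (4 * d\<^sup>2) * (1 / dist x y))"
        by (intro ennreal_leI mult_right_mono w) auto
      also have "\<dots> = ennreal (9 / (4 * d\<^sup>2)) * (ennreal (1 / dist y x) * indicator (ball y \<rho>) x)"
        using True d by (simp add: ennreal_mult[symmetric] dist_commute)
      finally show ?thesis unfolding lhs by (rule order_trans) simp
    next
      case False
      have "ennreal (hyp_weight x * (1 / dist x y)) \<le> ennreal (1 / \<rho> * hyp_weight x)"
        using False \<rho> by (subst mult.commute, intro ennreal_leI mult_right_mono frac_le) auto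
      also have "\<dots> = ennreal (1 / \<rho>) * (indicator A x * ennreal (hyp_weight x))"
        using \<open>x \<in> A \<and> _\<close> \<rho> by (simp add: ennreal_mult[symmetric])
      finally show ?thesis unfolding lhs by (rule order_trans) simp
    qed
  qed (auto simp: ker1_def)
  have "(\<integral>\<^sup>+x. indicator A x * ennreal (hyp_weight x) * ker1 x y \<partial>lborel)
    \<le> (\<integral>\<^sup>+x. ennreal (9 / (4 * d\<^sup>2)) * (ennreal (1 / dist y x) * indicator (ball y \<rho>) x)
       + ennreal (1 / \<rho>) * (indicator A x * ennreal (hyp_weight x)) \<partial>lborel)"
    by (intro nn_integral_mono pt)
  also have "\<dots> = ennreal (9 / (4 * d\<^sup>2)) * (\<integral>\<^sup>+x. ennreal (1 / dist y x) * indicator (ball y \<rho>) x \<partial>lborel)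
       + ennreal (1 / \<rho>) * ennreal a"
    unfolding a(1)[symmetric] by (subst nn_integral_add) (measurable, simp add: nn_integral_cmult)
  also have "\<dots> \<le> ennreal (9 / (4 * d\<^sup>2)) * ennreal (2 * pi * \<rho>) + ennreal (1 / \<rho>) * ennreal a"
    by (intro add_mono mult_left_mono nn_integral_inverse_dist_ball \<rho>) auto
  also have "\<dots> = ennreal (9 / (4 * d\<^sup>2) * (2 * pi * \<rho>) + 1 / \<rho> * a)"
    using d \<rho> a by (simp add: ennreal_mult[symmetric] ennreal_plus[symmetric] del: ennreal_plus)
  also have "9 / (4 * d\<^sup>2) * (2 * pi * \<rho>) + 1 / \<rho> * a = (9 / 2 * pi + 1) * (sqrt a / d)"
  proof -
    have "a = sqrt a * sqrt a" using a by simp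
    then have "1 / \<rho> * a = sqrt a / d" using a d unfolding \<rho>_def by (simp add: field_simps)
    moreover have "9 / (4 * d\<^sup>2) * (2 * pi * \<rho>) = 9 / 2 * pi * (sqrt a / d)"
      unfolding \<rho>_def using d by (simp add: power2_eq_square)
    ultimately show ?thesis by (simp add: algebra_simps)
  qed
  \<comment> \<open>\<open>9 / 2 * pi + 1\<close> is below 19 since \<open>pi < 4\<close>.\<close>
  also have "ennreal \<dots> \<le> ennreal (20 * (sqrt a / d))"
    using a d pi_less_4 by (intro ennreal_leI mult_right_mono) auto
  finally show ?thesis by (simp add: d_def)
qed

lemma ennreal_mult_le_squares:
  fixes x y :: ennreal
  assumes "c > 0"
  shows "x * y \<le> ennreal (c / 2) * x\<^sup>2 + ennreal (1 / (2 * c)) * y\<^sup>2"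
proof (cases "x = top \<or> y = top")
  case True
  then show ?thesis using assms by (auto simp: ennreal_mult_top)
next
  case False
  then obtain u v where uv: "x = ennreal u" "u \<ge> 0" "y = ennreal v" "v \<ge> 0"
    by (metis ennreal_cases)
  have "0 \<le> (c * u - v)\<^sup>2 / (2 * c)" using assms by simp
  also have "\<dots> = c / 2 * u\<^sup>2 + 1 / (2 * c) * v\<^sup>2 - u * v"
    using assms by (simp add: power2_eq_square field_simps)
  finally have "u * v \<le> c / 2 * u\<^sup>2 + 1 / (2 * c) * v\<^sup>2" by simp
  then have "ennreal (u * v) \<le> ennreal (c / 2 * u\<^sup>2 + 1 / (2 * c) * v\<^sup>2)" by (rule ennreal_leI)
  also have "\<dots> = ennreal (c / 2) * x\<^sup>2 + ennreal (1 / (2 * c)) * y\<^sup>2"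
    using assms uv by (simp add: ennreal_mult[symmetric] ennreal_power)
  finally show ?thesis using uv by (simp add: ennreal_mult)
qed

text \<open>The logarithm of the capacity estimate arises here. The annulus between the radii
  \<open>d * sqrt a\<close> and \<open>d * sqrt b\<close> contributes
  \<open>2 * pi * ln (sqrt b / sqrt a) + pi\<close>. Beyond it the squared kernel is at most
  \<open>9 / b\<close> times the weight, where \<open>9 = 4 * (3 / 2)\<^sup>2\<close>, and the
  weight has mass \<open>b\<close> on \<open>B\<close>.\<close>

lemma nn_integral_ker1_outside_ball:
  assumes [measurable]: "B \<in> sets borel" and B: "B \<subseteq> ball 0 1"
    and b: "(\<integral>\<^sup>+x. indicator B x * ennreal (hyp_weight x) \<partial>lborel) = ennreal b"
    and a: "0 < a" "a \<le> b" and x: "norm x < 1"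
  shows "(\<integral>\<^sup>+y. indicator B y * indicator (- ball x ((1 - norm x) * sqrt a)) y * (ker1 x y)\<^sup>2 \<partial>lborel)
    \<le> ennreal (pi * ln (b / a) + pi + 9)"
proof -
  define d where "d = 1 - norm x"
  define r R where "r = d * sqrt a" and "R = d * sqrt b"
  have d: "d > 0" using x by (simp add: d_def)
  have rR: "0 < r" "r \<le> R" using d a by (auto simp: r_def R_def)
  have pt: "indicator B y * indicator (- ball x r) y * (ker1 x y)\<^sup>2
    \<le> ennreal (1 / (dist x y)\<^sup>2) * indicator (ball x R - ball x r) y
      + ennreal (9 / b) * (indicator B y * ennreal (hyp_weight y))" for y
  proof (cases "y \<in> B \<and> r \<le> dist x y \<and> dist x y < d / 2")
    case True
    have k: "(ker1 x y)\<^sup>2 = ennreal (1 / (dist x y)\<^sup>2)"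
      using True by (simp add: ker1_def d_def ennreal_power power_one_over)
    show ?thesis
    proof (cases "dist x y < R")
      case True
      then show ?thesis using \<open>y \<in> B \<and> _\<close> by (simp add: k)
    next
      case False
      have ny: "norm y < 1" using True B by auto
      have "norm y \<ge> norm x - dist x y" using norm_triangle_ineq3[of x y] by (simp add: dist_norm)
      then have dy: "1 - norm y \<le> 3 / 2 * d" using True by (simp add: d_def)
      have "R\<^sup>2 \<le> (dist x y)\<^sup>2" using False rR by (intro power_mono) auto
      then have "1 / (dist x y)\<^sup>2 \<le> 1 / R\<^sup>2" using rR by (intro frac_le) auto
      also have "\<dots> = 9 / b * (1 / (4 * (3 / 2 * d)\<^sup>2))" using a d by (simp add: R_def power_mult_distrib power2_eq_square)
      also have "\<dots> \<le> 9 / b * (1 / (4 * (1 - norm y)\<^sup>2))"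
        using ny dy a by (intro mult_left_mono frac_le mult_left_mono power_mono) auto
      also have "\<dots> \<le> 9 / b * hyp_weight y"
        using a by (intro mult_left_mono hyp_weight_bounds ny) auto
      finally have "ennreal (1 / (dist x y)\<^sup>2) \<le> ennreal (9 / b * hyp_weight y)" by (rule ennreal_leI)
      also have "\<dots> = ennreal (9 / b) * ennreal (hyp_weight y)"
        using a by (intro ennreal_mult) auto
      finally show ?thesis using \<open>y \<in> B \<and> _\<close> False by (simp add: k)
    qed
  qed (auto simp: ker1_def d_def)
  have "(\<integral>\<^sup>+y. indicator B y * indicator (- ball x r) y * (ker1 x y)\<^sup>2 \<partial>lborel)
    \<le> (\<integral>\<^sup>+y. ennreal (1 / (dist x y)\<^sup>2) * indicator (ball x R - ball x r) y
      + ennreal (9 / b) * (indicator B y * ennreal (hyp_weight y)) \<partial>lborel)"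
    by (intro nn_integral_mono pt)
  also have "\<dots> = (\<integral>\<^sup>+y. ennreal (1 / (dist x y)\<^sup>2) * indicator (ball x R - ball x r) y \<partial>lborel)
      + ennreal (9 / b) * ennreal b"
    unfolding b[symmetric] by (subst nn_integral_add) (measurable, simp add: nn_integral_cmult)
  also have "\<dots> \<le> ennreal (pi + 2 * pi * ln (R / r)) + ennreal (9 / b) * ennreal b"
    by (intro add_mono nn_integral_inverse_dist_sq_annulus rR order_refl)
  also have "\<dots> = ennreal (pi + 2 * pi * ln (R / r) + 9)"
  proof -
    have "ennreal (9 / b) * ennreal b = ennreal 9"
      using a by (subst ennreal_mult[symmetric]) auto
    then show ?thesis using rR by (simp only:) (rule ennreal_plus[symmetric]; simp)
  qed
  also have "ln (R / r) = ln (b / a) / 2"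
    using a d by (simp add: r_def R_def real_sqrt_divide[symmetric] ln_sqrt)
  finally show ?thesis by (simp add: r_def d_def algebra_simps)
qed

text \<open>Near \<open>x\<close> the square of the kernel is not integrable, so the potential is
  estimated pointwise: \<open>1 - norm y\<close> exceeds half of \<open>1 - norm x\<close>, which
  bounds it by \<open>40 * sqrt a / d\<close>, and the kernel integrates to at most
  \<open>2 * pi * (d * sqrt a)\<close>.\<close>

lemma nn_integral_ker1_potential_inside_ball:
  assumes [measurable]: "A \<in> sets borel" and A: "A \<subseteq> ball 0 1"
    and a: "(\<integral>\<^sup>+x. indicator A x * ennreal (hyp_weight x) \<partial>lborel) = ennreal a" "a > 0"
    and x: "norm x < 1"
  shows "(\<integral>\<^sup>+y. indicator (ball x ((1 - norm x) * sqrt a)) y * (ker1 x y *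
      (\<integral>\<^sup>+x'. indicator A x' * ennreal (hyp_weight x') * ker1 x' y \<partial>lborel)) \<partial>lborel) \<le> ennreal (80 * pi * a)"
proof -
  define d where "d = 1 - norm x"
  have d: "d > 0" using x by (simp add: d_def)
  let ?P = "\<lambda>y. \<integral>\<^sup>+x'. indicator A x' * ennreal (hyp_weight x') * ker1 x' y \<partial>lborel"
  have pt: "indicator (ball x (d * sqrt a)) y * (ker1 x y * ?P y)
    \<le> ennreal (40 * sqrt a / d) * (ennreal (1 / dist x y) * indicator (ball x (d * sqrt a)) y)" for y
  proof (cases "dist x y < d / 2")
    case True
    have "norm y \<le> norm x + dist x y" using norm_triangle_ineq2[of y x] by (simp add: dist_norm norm_minus_commute)
    then have dy: "d / 2 < 1 - norm y" using True by (simp add: d_def field_simps)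
    have "?P y \<le> ennreal (20 * sqrt a / (1 - norm y))"
      using dy d by (intro ker1_average_bound A a) auto
    also have "\<dots> \<le> ennreal (20 * sqrt a / (d / 2))"
      using dy d a by (intro ennreal_leI frac_le) auto
    finally have P: "?P y \<le> ennreal (40 * sqrt a / d)" by simp
    have "ker1 x y * ?P y \<le> ennreal (1 / dist x y) * ennreal (40 * sqrt a / d)"
      using P by (intro mult_mono) (auto simp: ker1_def indicator_def)
    then show ?thesis by (auto simp: indicator_def mult_ac)
  qed (simp add: ker1_def d_def)
  have "(\<integral>\<^sup>+y. indicator (ball x (d * sqrt a)) y * (ker1 x y * ?P y) \<partial>lborel)
    \<le> (\<integral>\<^sup>+y. ennreal (40 * sqrt a / d) * (ennreal (1 / dist x y) * indicator (ball x (d * sqrt a)) y) \<partial>lborel)"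
    by (intro nn_integral_mono pt)
  also have "\<dots> = ennreal (40 * sqrt a / d) * (\<integral>\<^sup>+y. ennreal (1 / dist x y) * indicator (ball x (d * sqrt a)) y \<partial>lborel)"
    by (rule nn_integral_cmult) measurable
  also have "\<dots> \<le> ennreal (40 * sqrt a / d) * ennreal (2 * pi * (d * sqrt a))"
    using d a by (intro mult_left_mono nn_integral_inverse_dist_ball) auto
  also have "\<dots> = ennreal (80 * pi * (sqrt a * sqrt a))"
    using d a by (simp add: ennreal_mult[symmetric] field_simps del: real_sqrt_mult_self)
  finally show ?thesis using a by (simp add: d_def)
qed

text \<open>Expand one factor of the square and apply Fubini, so that the square integral
  \<open>X\<close> becomes an average over \<open>A\<close> of integrals of
  \<open>ker1 x y * P y\<close>. Near \<open>x\<close> these are bounded by the pointwise estimate.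
  Elsewhere Young's inequality gives half of the squared kernel plus a multiple of \<open>X\<close>
  that can be absorbed. Doubling restores the coefficient \<open>pi\<close> of the logarithm
  exactly; only additive constants are lost.\<close>

lemma ker1_potential_square:
  assumes [measurable]: "A \<in> sets borel" "B \<in> sets borel" and AB: "A \<subseteq> ball 0 1" "B \<subseteq> ball 0 1"
    and a: "(\<integral>\<^sup>+x. indicator A x * ennreal (hyp_weight x) \<partial>lborel) = ennreal a" "a > 0"
    and b: "(\<integral>\<^sup>+x. indicator B x * ennreal (hyp_weight x) \<partial>lborel) = ennreal b" "a \<le> b"
  shows "(\<integral>\<^sup>+y. indicator B y * (\<integral>\<^sup>+x. indicator A x * ennreal (hyp_weight x) * ker1 x y \<partial>lborel)\<^sup>2 \<partial>lborel)
    \<le> ennreal (a\<^sup>2 * (pi * ln (b / a) + pi + 9 + 160 * pi))" (is "?X \<le> _")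
proof -
  let ?\<alpha> = "\<lambda>x. indicator A x * ennreal (hyp_weight x)"
  define P where "P = (\<lambda>y. \<integral>\<^sup>+x. ?\<alpha> x * ker1 x y \<partial>lborel)"
  have [measurable]: "P \<in> borel_measurable borel" unfolding P_def by measurable
  define c where "c = pi * ln (b / a) + pi + 9"
  have c: "c \<ge> 0" unfolding c_def using a b by simp
  have X: "?X = (\<integral>\<^sup>+y. indicator B y * (P y)\<^sup>2 \<partial>lborel)" by (simp add: P_def)
  let ?ins = "\<lambda>x y. indicator (ball x ((1 - norm x) * sqrt a)) y :: ennreal"
  let ?out = "\<lambda>x y. indicator (- ball x ((1 - norm x) * sqrt a)) y :: ennreal"
  \<comment> \<open>Absorbing half of \<open>?X\<close> below requires finiteness. The squared
    pointwise bound on the potential is at most a multiple of the weight, whose integral over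
    \<open>B\<close> is \<open>b\<close>.\<close>
  have fin: "?X < top"
  proof -
    have "?X \<le> (\<integral>\<^sup>+y. ennreal (1600 * a) * (indicator B y * ennreal (hyp_weight y)) \<partial>lborel)"
      unfolding X
    proof (intro nn_integral_mono)
      fix y
      show "indicator B y * (P y)\<^sup>2 \<le> ennreal (1600 * a) * (indicator B y * ennreal (hyp_weight y))"
      proof (cases "y \<in> B")
        case True
        then have ny: "norm y < 1" using AB by auto
        have "(P y)\<^sup>2 \<le> (ennreal (20 * sqrt a / (1 - norm y)))\<^sup>2"
          unfolding P_def by (intro power_mono ker1_average_bound AB a ny) auto
        also have "\<dots> = ennreal ((20 * sqrt a / (1 - norm y))\<^sup>2)" using a ny by (simp add: ennreal_power)
        also have "(20 * sqrt a / (1 - norm y))\<^sup>2 = 1600 * a * (1 / (4 * (1 - norm y)\<^sup>2))"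
          using a by (simp add: power_divide power_mult_distrib)
        also have "ennreal \<dots> \<le> ennreal (1600 * a * hyp_weight y)"
          using a by (intro ennreal_leI mult_left_mono hyp_weight_bounds ny) auto
        finally show ?thesis using True a by (simp add: ennreal_mult)
      qed simp
    qed
    also have "\<dots> = ennreal (1600 * a) * ennreal b" unfolding b(1)[symmetric] by (rule nn_integral_cmult) measurable
    also have "\<dots> < top" by (simp add: ennreal_mult_less_top)
    finally show ?thesis .
  qed
  have inner: "(\<integral>\<^sup>+y. indicator B y * (ker1 x y * P y) \<partial>lborel)
      \<le> ennreal (80 * pi * a + a / 2 * c) + ennreal (1 / (2 * a)) * ?X" if "norm x < 1" for x
  proof -
    \<comment> \<open>The parameter of Young's inequality is \<open>a\<close>: after integration
      against the mass \<open>a\<close> the coefficient \<open>1 / (2 * a)\<close> becomes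
      \<open>1 / 2\<close>.\<close>
    have "(\<integral>\<^sup>+y. indicator B y * (ker1 x y * P y) \<partial>lborel)
      \<le> (\<integral>\<^sup>+y. ?ins x y * (ker1 x y * P y) + (ennreal (a / 2) * (indicator B y * ?out x y * (ker1 x y)\<^sup>2)
          + ennreal (1 / (2 * a)) * (indicator B y * (P y)\<^sup>2)) \<partial>lborel)"
    proof (intro nn_integral_mono)
      fix y
      show "indicator B y * (ker1 x y * P y) \<le> ?ins x y * (ker1 x y * P y) + (ennreal (a / 2) * (indicator B y * ?out x y * (ker1 x y)\<^sup>2)
          + ennreal (1 / (2 * a)) * (indicator B y * (P y)\<^sup>2))"
        using ennreal_mult_le_squares[OF a(2), of "ker1 x y" "P y"] by (simp add: indicator_def)
    qed
    also have "\<dots> = (\<integral>\<^sup>+y. ?ins x y * (ker1 x y * P y) \<partial>lborel)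
       + (ennreal (a / 2) * (\<integral>\<^sup>+y. indicator B y * ?out x y * (ker1 x y)\<^sup>2 \<partial>lborel)
       + ennreal (1 / (2 * a)) * ?X)"
      unfolding X by (simp add: nn_integral_add nn_integral_cmult)
    also have "\<dots> \<le> ennreal (80 * pi * a) + (ennreal (a / 2) * ennreal c + ennreal (1 / (2 * a)) * ?X)"
      unfolding P_def c_def using that a b
      by (intro add_mono mult_left_mono nn_integral_ker1_potential_inside_ball nn_integral_ker1_outside_ball AB order_refl) auto
    also have "ennreal (a / 2) * ennreal c = ennreal (a / 2 * c)" using a c by (simp add: ennreal_mult[symmetric])
    also have "ennreal (80 * pi * a) + (ennreal (a / 2 * c) + ennreal (1 / (2 * a)) * ?X)
       = ennreal (80 * pi * a + a / 2 * c) + ennreal (1 / (2 * a)) * ?X"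
      using a c by (simp add: add.assoc)
    finally show ?thesis .
  qed
  have "?X = (\<integral>\<^sup>+y. \<integral>\<^sup>+x. ?\<alpha> x * (indicator B y * (ker1 x y * P y)) \<partial>lborel \<partial>lborel)"
  proof (unfold X, intro nn_integral_cong)
    fix y
    have "indicator B y * (P y)\<^sup>2 = (\<integral>\<^sup>+x. ?\<alpha> x * ker1 x y \<partial>lborel) * (indicator B y * P y)"
      by (simp add: P_def power2_eq_square mult_ac)
    also have "\<dots> = (\<integral>\<^sup>+x. ?\<alpha> x * ker1 x y * (indicator B y * P y) \<partial>lborel)"
      by (rule nn_integral_multc[symmetric]) measurable
    finally show "indicator B y * (P y)\<^sup>2 = (\<integral>\<^sup>+x. ?\<alpha> x * (indicator B y * (ker1 x y * P y)) \<partial>lborel)"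
      by (simp add: mult_ac)
  qed
  also have "\<dots> = (\<integral>\<^sup>+x. \<integral>\<^sup>+y. ?\<alpha> x * (indicator B y * (ker1 x y * P y)) \<partial>lborel \<partial>lborel)"
    by (rule lborel_pair.Fubini') measurable
  also have "\<dots> = (\<integral>\<^sup>+x. ?\<alpha> x * (\<integral>\<^sup>+y. indicator B y * (ker1 x y * P y) \<partial>lborel) \<partial>lborel)"
    by (intro nn_integral_cong nn_integral_cmult) measurable
  also have "\<dots> \<le> (\<integral>\<^sup>+x. ?\<alpha> x * (ennreal (80 * pi * a + a / 2 * c) + ennreal (1 / (2 * a)) * ?X) \<partial>lborel)"
    using AB inner by (intro nn_integral_mono) (auto simp: indicator_def intro!: mult_left_mono)
  also have "\<dots> = ennreal a * (ennreal (80 * pi * a + a / 2 * c) + ennreal (1 / (2 * a)) * ?X)"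
    unfolding a(1)[symmetric] by (rule nn_integral_multc) measurable
  also have "\<dots> = ennreal (a * (80 * pi * a + a / 2 * c)) + ennreal (1 / 2) * ?X"
    using a c by (simp add: distrib_left ennreal_mult mult.assoc[symmetric]) (simp add: ennreal_mult[symmetric])
  finally have main: "?X \<le> ennreal (a * (80 * pi * a + a / 2 * c)) + ennreal (1 / 2) * ?X" .
  from fin obtain X' where X': "?X = ennreal X'" "X' \<ge> 0" by (cases ?X) auto
  have "ennreal X' \<le> ennreal (a * (80 * pi * a + a / 2 * c) + 1 / 2 * X')"
  proof -
    have "ennreal (1 / 2) * ennreal X' = ennreal (1 / 2 * X')"
      using X'(2) by (intro ennreal_mult[symmetric]) auto
    moreover have "ennreal (a * (80 * pi * a + a / 2 * c)) + ennreal (1 / 2 * X')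
        = ennreal (a * (80 * pi * a + a / 2 * c) + 1 / 2 * X')"
      using a c X'(2) by (intro ennreal_plus[symmetric]) auto
    ultimately show ?thesis using main unfolding X'(1) by (simp only:)
  qed
  then have "X' \<le> a * (80 * pi * a + a / 2 * c) + 1 / 2 * X'"
    using a c X'(2) by (subst (asm) ennreal_le_iff) auto
  then have "X' \<le> a\<^sup>2 * (c + 160 * pi)" by (simp add: algebra_simps power2_eq_square)
  then show ?thesis unfolding X'(1) c_def by (rule ennreal_leI)
qed

text \<open>With \<open>d\<close> the smaller of the two distances to the boundary, the product is
  at most \<open>(16 / d)\<^sup>2\<close> on a ball of area \<open>9 * pi * d\<^sup>2\<close>, and
  \<open>d\<close> cancels.\<close>

lemma ker2_ker2_integral:
  assumes x: "norm x < 1" and x': "norm x' < 1"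
  shows "(\<integral>\<^sup>+y. ker2 x y * ker2 x' y \<partial>lborel) \<le> ennreal (2304 * pi)"
proof -
  have *: "(\<integral>\<^sup>+y. ker2 x y * ker2 x' y \<partial>lborel) \<le> ennreal (2304 * pi)"
    if "norm x < 1" "norm x' < 1" "1 - norm x \<le> 1 - norm x'" for x x'
  proof -
    define d d' where "d = 1 - norm x" and "d' = 1 - norm x'"
    have d: "0 < d" "d \<le> d'" using that by (auto simp: d_def d'_def)
    have "(\<integral>\<^sup>+y. ker2 x y * ker2 x' y \<partial>lborel)
      \<le> (\<integral>\<^sup>+y. ennreal (16 / d * (16 / d)) * indicator (ball x (3 * d)) y \<partial>lborel)"
    proof (intro nn_integral_mono)
      fix y
      have "ker2 x y * ker2 x' y \<le> (indicator (ball x (3 * d)) y * ennreal (16 / d)) * ennreal (16 / d')"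
        unfolding ker2_def d_def[symmetric] d'_def[symmetric]
        by (intro mult_left_mono) (auto simp: indicator_def)
      also have "\<dots> \<le> (indicator (ball x (3 * d)) y * ennreal (16 / d)) * ennreal (16 / d)"
        using d by (intro mult_left_mono ennreal_leI frac_le) auto
      also have "\<dots> = ennreal (16 / d * (16 / d)) * indicator (ball x (3 * d)) y"
        using d by (simp add: ennreal_mult[symmetric] mult_ac indicator_def)
      finally show "ker2 x y * ker2 x' y \<le> ennreal (16 / d * (16 / d)) * indicator (ball x (3 * d)) y" .
    qed
    also have "\<dots> = ennreal (16 / d * (16 / d)) * ennreal (pi * (3 * d)\<^sup>2)"
      using d by (simp add: nn_integral_cmult_indicator emeasure_ball_plane)
    also have "\<dots> = ennreal (2304 * pi)"
      using d by (simp add: ennreal_mult[symmetric] power2_eq_square)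
    finally show ?thesis .
  qed
  show ?thesis
    using *[OF x x'] *[OF x' x] by (cases "1 - norm x \<le> 1 - norm x'") (auto simp: mult.commute)
qed

text \<open>If the two supports share a point \<open>z\<close>, then \<open>1 - norm z\<close> is at
  most \<open>4 * d\<close> and at least \<open>d' / 2\<close>, whence
  \<open>d' \<le> 8 * d\<close>. The integral is then at most \<open>16 / d\<close> times
  \<open>pi * d'\<close>.\<close>

lemma ker2_ker1_integral:
  assumes x: "norm x < 1" and x': "norm x' < 1"
  shows "(\<integral>\<^sup>+y. ker2 x y * ker1 x' y \<partial>lborel) \<le> ennreal (128 * pi)"
proof (cases "\<exists>y. dist x y < 3 * (1 - norm x) \<and> dist x' y < (1 - norm x') / 2")
  case True
  then obtain z where z: "dist x z < 3 * (1 - norm x)" "dist x' z < (1 - norm x') / 2" by blast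
  define d d' where "d = 1 - norm x" and "d' = 1 - norm x'"
  have d: "0 < d" "0 < d'" using x x' by (auto simp: d_def d'_def)
  have "norm x - norm z \<le> dist x z" "norm z - norm x' \<le> dist x' z"
    using norm_triangle_ineq2[of x z] norm_triangle_ineq2[of z x'] by (auto simp: dist_norm norm_minus_commute)
  then have d8: "d' \<le> 8 * d" using z by (simp add: d_def d'_def)
  have "(\<integral>\<^sup>+y. ker2 x y * ker1 x' y \<partial>lborel)
    \<le> (\<integral>\<^sup>+y. ennreal (16 / d) * (ennreal (1 / dist x' y) * indicator (ball x' (d' / 2)) y) \<partial>lborel)"
    by (intro nn_integral_mono) (auto simp: ker1_def ker2_def d_def d'_def indicator_def)
  also have "\<dots> = ennreal (16 / d) * (\<integral>\<^sup>+y. ennreal (1 / dist x' y) * indicator (ball x' (d' / 2)) y \<partial>lborel)"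
    by (rule nn_integral_cmult) measurable
  also have "\<dots> \<le> ennreal (16 / d) * ennreal (2 * pi * (d' / 2))"
    using d by (intro mult_left_mono nn_integral_inverse_dist_ball) auto
  also have "\<dots> = ennreal (16 * pi * (d' / d))"
    using d by (simp add: ennreal_mult[symmetric])
  also have "\<dots> \<le> ennreal (16 * pi * 8)"
    using d d8 by (intro ennreal_leI mult_left_mono) (auto simp: pos_divide_le_eq)
  finally show ?thesis by simp
next
  case False
  then have "ker2 x y * ker1 x' y = 0" for y by (auto simp: ker1_def ker2_def indicator_def)
  then show ?thesis by (simp only: nn_integral_const mult_zero_left zero_le)
qed

text \<open>Fubini reduces the integral to the overlaps of pairs of kernels. This serves the pairs
  that involve \<open>ker2\<close>. The overlap of \<open>ker1 x\<close> with \<open>ker1 x'\<close>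
  is unbounded as \<open>x'\<close> approaches \<open>x\<close>, which is why that pair has an
  argument of its own.\<close>

lemma potential_energy_bound:
  fixes k k' :: "'a::euclidean_space \<Rightarrow> 'a \<Rightarrow> ennreal"
  assumes [measurable]: "\<alpha> \<in> borel_measurable borel"
    "case_prod k \<in> borel_measurable (borel \<Otimes>\<^sub>M borel)" "case_prod k' \<in> borel_measurable (borel \<Otimes>\<^sub>M borel)"
    and c: "\<And>x x'. \<alpha> x \<noteq> 0 \<Longrightarrow> \<alpha> x' \<noteq> 0 \<Longrightarrow> (\<integral>\<^sup>+y. k x y * k' x' y \<partial>lborel) \<le> c"
  shows "(\<integral>\<^sup>+y. (\<integral>\<^sup>+x. \<alpha> x * k x y \<partial>lborel) * (\<integral>\<^sup>+x. \<alpha> x * k' x y \<partial>lborel) \<partial>lborel)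
    \<le> c * (\<integral>\<^sup>+x. \<alpha> x \<partial>lborel)\<^sup>2"
proof -
  have "(\<integral>\<^sup>+y. (\<integral>\<^sup>+x. \<alpha> x * k x y \<partial>lborel) * (\<integral>\<^sup>+x. \<alpha> x * k' x y \<partial>lborel) \<partial>lborel)
    = (\<integral>\<^sup>+y. \<integral>\<^sup>+x. \<alpha> x * (k x y * (\<integral>\<^sup>+x'. \<alpha> x' * k' x' y \<partial>lborel)) \<partial>lborel \<partial>lborel)"
    by (intro nn_integral_cong) (simp add: nn_integral_multc[symmetric] mult.assoc)
  also have "\<dots> = (\<integral>\<^sup>+x. \<integral>\<^sup>+y. \<alpha> x * (k x y * (\<integral>\<^sup>+x'. \<alpha> x' * k' x' y \<partial>lborel)) \<partial>lborel \<partial>lborel)"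
    by (rule lborel_pair.Fubini') measurable
  also have "\<dots> = (\<integral>\<^sup>+x. \<alpha> x * (\<integral>\<^sup>+y. \<integral>\<^sup>+x'. \<alpha> x' * (k x y * k' x' y) \<partial>lborel \<partial>lborel) \<partial>lborel)"
    by (intro nn_integral_cong) (simp add: nn_integral_cmult[symmetric] mult_ac)
  also have "\<dots> = (\<integral>\<^sup>+x. \<alpha> x * (\<integral>\<^sup>+x'. \<integral>\<^sup>+y. \<alpha> x' * (k x y * k' x' y) \<partial>lborel \<partial>lborel) \<partial>lborel)"
    by (intro nn_integral_cong arg_cong2[of _ _ _ _ "(*)"] refl lborel_pair.Fubini') measurable
  also have "\<dots> = (\<integral>\<^sup>+x. \<alpha> x * (\<integral>\<^sup>+x'. \<alpha> x' * (\<integral>\<^sup>+y. k x y * k' x' y \<partial>lborel) \<partial>lborel) \<partial>lborel)"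
    by (simp add: nn_integral_cmult)
  also have "\<dots> \<le> (\<integral>\<^sup>+x. \<alpha> x * (\<integral>\<^sup>+x'. \<alpha> x' * c \<partial>lborel) \<partial>lborel)"
  proof (intro nn_integral_mono)
    fix x
    show "\<alpha> x * (\<integral>\<^sup>+x'. \<alpha> x' * (\<integral>\<^sup>+y. k x y * k' x' y \<partial>lborel) \<partial>lborel)
      \<le> \<alpha> x * (\<integral>\<^sup>+x'. \<alpha> x' * c \<partial>lborel)"
    proof (cases "\<alpha> x = 0")
      case False
      have "\<alpha> x' * (\<integral>\<^sup>+y. k x y * k' x' y \<partial>lborel) \<le> \<alpha> x' * c" for x'
        using c[OF False, of x'] by (cases "\<alpha> x' = 0") (auto intro: mult_left_mono)
      then show ?thesis by (intro mult_left_mono[OF nn_integral_mono]) auto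
    qed simp
  qed
  also have "\<dots> = c * (\<integral>\<^sup>+x. \<alpha> x \<partial>lborel)\<^sup>2"
    by (simp add: nn_integral_cmult nn_integral_multc power2_eq_square mult_ac)
  finally show ?thesis .
qed

text \<open>Only the square of the \<open>ker1\<close> potential produces a logarithm; the mixed and
  the \<open>ker2\<close> terms have overlaps bounded by absolute constants.\<close>

lemma potential_square:
  assumes [measurable]: "A \<in> sets borel" "B \<in> sets borel" and AB: "A \<subseteq> ball 0 1" "B \<subseteq> ball 0 1"
    and a: "(\<integral>\<^sup>+x. indicator A x * ennreal (hyp_weight x) \<partial>lborel) = ennreal a" "a > 0"
    and b: "(\<integral>\<^sup>+x. indicator B x * ennreal (hyp_weight x) \<partial>lborel) = ennreal b" "a \<le> b"
  shows "(\<integral>\<^sup>+y. indicator B y * (\<integral>\<^sup>+x. indicator A x * ennreal (hyp_weight x) * (ker1 x y + ker2 x y) \<partial>lborel)\<^sup>2 \<partial>lborel)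
    \<le> ennreal (a\<^sup>2 * pi * (ln (b / a) + 3000))"
proof -
  let ?\<alpha> = "\<lambda>x. indicator A x * ennreal (hyp_weight x)"
  define P1 where "P1 = (\<lambda>y. \<integral>\<^sup>+x. ?\<alpha> x * ker1 x y \<partial>lborel)"
  define P2 where "P2 = (\<lambda>y. \<integral>\<^sup>+x. ?\<alpha> x * ker2 x y \<partial>lborel)"
  have [measurable]: "P1 \<in> borel_measurable borel" "P2 \<in> borel_measurable borel"
    unfolding P1_def P2_def by measurable
  have A: "norm x < 1" if "?\<alpha> x \<noteq> 0" for x using that AB by (auto simp: indicator_def split: if_splits)
  have "(\<integral>\<^sup>+y. P2 y * P1 y \<partial>lborel) \<le> ennreal (128 * pi) * (\<integral>\<^sup>+x. ?\<alpha> x \<partial>lborel)\<^sup>2"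
    unfolding P1_def P2_def by (intro potential_energy_bound ker2_ker1_integral A) auto
  then have P21: "(\<integral>\<^sup>+y. P2 y * P1 y \<partial>lborel) \<le> ennreal (128 * pi * a\<^sup>2)"
    using a by (simp add: ennreal_mult ennreal_power)
  have "(\<integral>\<^sup>+y. P2 y * P2 y \<partial>lborel) \<le> ennreal (2304 * pi) * (\<integral>\<^sup>+x. ?\<alpha> x \<partial>lborel)\<^sup>2"
    unfolding P2_def by (intro potential_energy_bound ker2_ker2_integral A) auto
  then have P22: "(\<integral>\<^sup>+y. P2 y * P2 y \<partial>lborel) \<le> ennreal (2304 * pi * a\<^sup>2)"
    using a by (simp add: ennreal_mult ennreal_power)
  have "(\<integral>\<^sup>+y. indicator B y * (\<integral>\<^sup>+x. ?\<alpha> x * (ker1 x y + ker2 x y) \<partial>lborel)\<^sup>2 \<partial>lborel)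
    = (\<integral>\<^sup>+y. indicator B y * (P1 y + P2 y)\<^sup>2 \<partial>lborel)"
    by (simp add: P1_def P2_def distrib_left nn_integral_add)
  also have "\<dots> \<le> (\<integral>\<^sup>+y. indicator B y * (P1 y)\<^sup>2 + (2 * (P2 y * P1 y) + P2 y * P2 y) \<partial>lborel)"
    by (intro nn_integral_mono) (auto simp: indicator_def power2_eq_square distrib_left distrib_right mult_2 mult_2_right
        add_ac mult.commute)
  also have "\<dots> = (\<integral>\<^sup>+y. indicator B y * (P1 y)\<^sup>2 \<partial>lborel) + (2 * (\<integral>\<^sup>+y. P2 y * P1 y \<partial>lborel) + (\<integral>\<^sup>+y. P2 y * P2 y \<partial>lborel))"
    by (simp add: nn_integral_add nn_integral_cmult)
  also have "\<dots> \<le> ennreal (a\<^sup>2 * (pi * ln (b / a) + pi + 9 + 160 * pi)) + (ennreal 2 * ennreal (128 * pi * a\<^sup>2) + ennreal (2304 * pi * a\<^sup>2))"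
    using P21 P22 unfolding P1_def
    by (intro add_mono mult_mono ker1_potential_square AB a b) (auto simp: P1_def)
  also have "\<dots> = ennreal (a\<^sup>2 * (pi * ln (b / a) + pi + 9 + 160 * pi) + (2 * (128 * pi * a\<^sup>2) + 2304 * pi * a\<^sup>2))"
  proof -
    have "0 \<le> ln (b / a)" using a b by simp
    then have u: "0 \<le> a\<^sup>2 * (pi * ln (b / a) + pi + 9 + 160 * pi)" by simp
    have "ennreal 2 * ennreal (128 * pi * a\<^sup>2) = ennreal (2 * (128 * pi * a\<^sup>2))"
      by (rule ennreal_mult[symmetric]) auto
    moreover have "ennreal (2 * (128 * pi * a\<^sup>2)) + ennreal (2304 * pi * a\<^sup>2)
        = ennreal (2 * (128 * pi * a\<^sup>2) + 2304 * pi * a\<^sup>2)"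
      by (rule ennreal_plus[symmetric]) auto
    moreover note ennreal_plus[OF u, of "2 * (128 * pi * a\<^sup>2) + 2304 * pi * a\<^sup>2"]
    ultimately show ?thesis by (simp only:) simp
  qed
  \<comment> \<open>The constants are \<open>161 * pi + 9\<close> from \<open>ker1\<close>,
    \<open>256 * pi\<close> from the mixed term and \<open>2304 * pi\<close> from
    \<open>ker2\<close>, and \<open>9 \<le> 279 * pi\<close>.\<close>
  also have "\<dots> \<le> ennreal (a\<^sup>2 * pi * (ln (b / a) + 3000))"
  proof (intro ennreal_leI)
    have "a\<^sup>2 * (pi * ln (b / a) + (2721 * pi + 9)) \<le> a\<^sup>2 * (pi * ln (b / a) + 3000 * pi)"
      using pi_gt3 by (intro mult_left_mono add_left_mono) auto
    then show "a\<^sup>2 * (pi * ln (b / a) + pi + 9 + 160 * pi) + (2 * (128 * pi * a\<^sup>2) + 2304 * pi * a\<^sup>2)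
      \<le> a\<^sup>2 * pi * (ln (b / a) + 3000)" by (simp add: algebra_simps)
  qed
  finally show ?thesis .
qed

section \<open>Capacity estimate for a slab\<close>

context C1_disk
begin

definition energy :: "real \<Rightarrow> real \<Rightarrow> ennreal" where
  "energy s t = (\<integral>\<^sup>+x. indicator {x. s < f x \<and> f x < t} x * ennreal ((norm (G x))\<^sup>2) \<partial>lborel)"

text \<open>Integrate the potential bound over \<open>{f \<ge> t}\<close> and exchange the
  integrals, so that the gradient in the slab is paired with the potential of that set. In the
  Cauchy-Schwarz inequality the potential is needed on the slab only, hence on
  \<open>{f > s}\<close>, which yields the logarithm of \<open>b / a\<close>. The strict inequality
  keeps this set inside the disk also for \<open>s = 0\<close>.\<close>

lemma capacity_estimate:
  assumes st: "0 \<le> s" "s \<le> t"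
    and a: "(\<integral>\<^sup>+x. indicator {x. t \<le> f x} x * ennreal (hyp_weight x) \<partial>lborel) = ennreal a" "a > 0" "0 < t"
    and b: "(\<integral>\<^sup>+x. indicator {x. s < f x} x * ennreal (hyp_weight x) \<partial>lborel) = ennreal b" "a \<le> b"
  shows "ennreal (4 * pi * (t - s)\<^sup>2) \<le> energy s t * ennreal (ln (b / a) + 3000)"
proof -
  let ?A = "{x. t \<le> f x}" and ?B = "{x. s < f x}"
  let ?\<alpha> = "\<lambda>x. indicator ?A x * ennreal (hyp_weight x)"
  let ?k = "\<lambda>x y. ker1 x y + ker2 x y"
  let ?P = "\<lambda>y. \<integral>\<^sup>+x. ?\<alpha> x * ?k x y \<partial>lborel"
  have ln0: "0 \<le> ln (b / a)" using a b by simp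
  have inside: "norm x < 1" if "0 < f x" for x
    using supp[of x] R that by (cases "norm x < 1") auto
  have AB: "?A \<subseteq> ball 0 1" "?B \<subseteq> ball 0 1"
    using inside a(3) st by auto
  have "ennreal (2 * pi * (t - s)) * ennreal a = (\<integral>\<^sup>+x. ?\<alpha> x * ennreal (2 * pi * (t - s)) \<partial>lborel)"
    unfolding a(1)[symmetric] by (subst nn_integral_multc) (auto simp: mult.commute)
  also have "\<dots> \<le> (\<integral>\<^sup>+x. ?\<alpha> x * (\<integral>\<^sup>+y. ?k x y * slab s t y \<partial>lborel) \<partial>lborel)"
    using AB by (intro nn_integral_mono) (auto simp: indicator_def intro!: mult_left_mono potential_bound st)
  also have "\<dots> = (\<integral>\<^sup>+x. \<integral>\<^sup>+y. ?\<alpha> x * (?k x y * slab s t y) \<partial>lborel \<partial>lborel)"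
    by (intro nn_integral_cong nn_integral_cmult[symmetric]) measurable
  also have "\<dots> = (\<integral>\<^sup>+y. \<integral>\<^sup>+x. ?\<alpha> x * (?k x y * slab s t y) \<partial>lborel \<partial>lborel)"
    by (rule lborel_pair.Fubini'[symmetric]) measurable
  also have "\<dots> = (\<integral>\<^sup>+y. slab s t y * (indicator ?B y * ?P y) \<partial>lborel)"
  proof (intro nn_integral_cong)
    fix y
    have "(\<integral>\<^sup>+x. ?\<alpha> x * (?k x y * slab s t y) \<partial>lborel) = (\<integral>\<^sup>+x. ?\<alpha> x * ?k x y * slab s t y \<partial>lborel)"
      by (simp add: mult.assoc)
    also have "\<dots> = ?P y * slab s t y" by (rule nn_integral_multc) measurable
    finally show "(\<integral>\<^sup>+x. ?\<alpha> x * (?k x y * slab s t y) \<partial>lborel) = slab s t y * (indicator ?B y * ?P y)"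
      by (simp add: slab_def indicator_def mult.commute)
  qed
  finally have "(ennreal (2 * pi * (t - s)) * ennreal a)\<^sup>2 \<le> (\<integral>\<^sup>+y. slab s t y * (indicator ?B y * ?P y) \<partial>lborel)\<^sup>2"
    by (rule power_mono) simp
  also have "\<dots> \<le> (\<integral>\<^sup>+y. (slab s t y)\<^sup>2 \<partial>lborel) * (\<integral>\<^sup>+y. (indicator ?B y * ?P y)\<^sup>2 \<partial>lborel)"
    by (rule Cauchy_Schwarz_nn_integral) measurable
  also have "(\<integral>\<^sup>+y. (slab s t y)\<^sup>2 \<partial>lborel) = energy s t"
    unfolding energy_def slab_def by (intro nn_integral_cong) (auto simp: indicator_def ennreal_power)
  also have "(\<integral>\<^sup>+y. (indicator ?B y * ?P y)\<^sup>2 \<partial>lborel) = (\<integral>\<^sup>+y. indicator ?B y * (?P y)\<^sup>2 \<partial>lborel)"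
    by (intro nn_integral_cong) (auto simp: indicator_def)
  also have "\<dots> \<le> ennreal (a\<^sup>2 * pi * (ln (b / a) + 3000))"
    by (intro potential_square AB a b) auto
  finally have "(ennreal (2 * pi * (t - s)) * ennreal a)\<^sup>2 \<le> energy s t * ennreal (a\<^sup>2 * pi * (ln (b / a) + 3000))"
    by (simp add: mult_left_mono)
  then have "ennreal (1 / (a\<^sup>2 * pi)) * (ennreal (2 * pi * (t - s)) * ennreal a)\<^sup>2
     \<le> ennreal (1 / (a\<^sup>2 * pi)) * (energy s t * ennreal (a\<^sup>2 * pi * (ln (b / a) + 3000)))"
    by (rule mult_left_mono) simp
  also have "\<dots> = energy s t * (ennreal (1 / (a\<^sup>2 * pi)) * ennreal (a\<^sup>2 * pi * (ln (b / a) + 3000)))"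
    by (simp only: mult_ac)
  also have "ennreal (1 / (a\<^sup>2 * pi)) * ennreal (a\<^sup>2 * pi * (ln (b / a) + 3000)) = ennreal (ln (b / a) + 3000)"
    using a ln0 by (subst ennreal_mult[symmetric]) auto
  also have "ennreal (1 / (a\<^sup>2 * pi)) * (ennreal (2 * pi * (t - s)) * ennreal a)\<^sup>2 = ennreal (4 * pi * (t - s)\<^sup>2)"
    using a st by (simp add: ennreal_mult[symmetric] ennreal_power power2_eq_square)
  finally show ?thesis .
qed

end

subsection \<open>Hardy's inequality\<close>

lemma integrable_continuous_compact_support:
  fixes \<psi> :: "'a::euclidean_space \<Rightarrow> real"
  assumes "continuous_on UNIV \<psi>" "\<And>x. r < norm x \<Longrightarrow> \<psi> x = 0"
  shows "integrable lborel \<psi>"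
proof -
  have "integrable lborel (\<lambda>x. indicator (cball 0 r) x *\<^sub>R \<psi> x)"
    by (intro borel_integrable_compact continuous_on_subset[OF assms(1)]) auto
  also have "(\<lambda>x. indicator (cball 0 r) x *\<^sub>R \<psi> x) = \<psi>"
    using assms(2) by (auto simp: indicator_def fun_eq_iff not_le)
  finally show ?thesis .
qed

text \<open>Difference quotients of an integrable function have integral 0 by translation
  invariance. They converge to the directional derivative and, by the Lipschitz bound, are dominated
  by a constant on a fixed ball.\<close>

lemma integral_directional_derivative:
  fixes \<psi> :: "'a::euclidean_space \<Rightarrow> real"
  assumes der: "\<And>x. (\<psi> has_derivative (\<lambda>h. D x \<bullet> h)) (at x)"
    and contD: "continuous_on UNIV D" and supp: "\<And>x. r < norm x \<Longrightarrow> \<psi> x = 0"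
  shows "integrable lborel (\<lambda>x. D x \<bullet> e)" "(\<integral>x. D x \<bullet> e \<partial>lborel) = 0"
proof -
  have cont: "continuous_on UNIV \<psi>"
    by (intro continuous_at_imp_continuous_on ballI has_derivative_continuous[OF der])
  have suppD: "D x = 0" if "r < norm x" for x
  proof -
    have "(\<psi> has_derivative (\<lambda>h. 0)) (at x)"
    proof (rule has_derivative_transform_within_open[of "\<lambda>_. 0"])
      show "open (- cball 0 r :: 'a set)" by auto
    qed (use that supp in auto)
    then have "(\<lambda>h. D x \<bullet> h) = (\<lambda>h. 0)" using has_derivative_unique[OF der] by blast
    then show ?thesis by (metis inner_eq_zero_iff)
  qed
  show intD: "integrable lborel (\<lambda>x. D x \<bullet> e)"
    by (rule integrable_continuous_compact_support[of _ r]) (auto intro!: continuous_intros contD simp: suppD)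
  have [measurable]: "\<psi> \<in> borel_measurable borel" using cont borel_measurable_continuous_onI by blast
  have [measurable]: "D \<in> borel_measurable borel" using contD borel_measurable_continuous_onI by blast
  have int\<psi>: "integrable lborel \<psi>"
    using cont supp by (rule integrable_continuous_compact_support)
  have "bounded (D ` cball 0 r)"
    by (intro compact_imp_bounded compact_continuous_image continuous_on_subset[OF contD]) auto
  then obtain M0 where M0: "\<forall>x\<in>cball 0 r. norm (D x) \<le> M0" by (auto simp: bounded_iff)
  define M where "M = max M0 0"
  have M: "norm (D x) \<le> M" for x
    using M0[rule_format, of x] suppD[of x] by (cases "norm x \<le> r") (auto simp: M_def le_max_iff_disj)
  have lip: "\<bar>\<psi> x - \<psi> y\<bar> \<le> M * norm (x - y)" for x y
  proof -
    have "norm (\<psi> x - \<psi> y) \<le> M * norm (x - y)"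
    proof (rule differentiable_bound[of UNIV])
      show "onorm (\<lambda>h. D z \<bullet> h) \<le> M" for z
        by (rule onorm_bound) (use M[of z] in \<open>auto simp: M_def intro!: order_trans[OF Cauchy_Schwarz_ineq2] mult_right_mono\<close>)
    qed (use der in auto)
    then show ?thesis by simp
  qed
  define q where "q n x = real (Suc n) * (\<psi> (x + (1 / real (Suc n)) *\<^sub>R e) - \<psi> x)" for n x
  have trans: "has_bochner_integral lborel (\<lambda>x. \<psi> (x + v)) (\<integral>x. \<psi> x \<partial>lborel)" for v
  proof -
    have "has_bochner_integral (distr lborel borel ((+) v)) \<psi> (\<integral>x. \<psi> x \<partial>lborel)"
      using int\<psi> by (simp add: lborel_distr_plus has_bochner_integral_integrable)
    then have "has_bochner_integral lborel (\<lambda>x. \<psi> (v + x)) (\<integral>x. \<psi> x \<partial>lborel)"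
      by (simp add: has_bochner_integral_iff integrable_distr_eq integral_distr)
    then show ?thesis by (simp add: add.commute)
  qed
  have q0: "(\<integral>x. q n x \<partial>lborel) = 0" for n
  proof -
    have "has_bochner_integral lborel (q n) (real (Suc n) * ((\<integral>x. \<psi> x \<partial>lborel) - (\<integral>x. \<psi> x \<partial>lborel)))"
      unfolding q_def by (intro has_bochner_integral_mult_right has_bochner_integral_diff trans
          has_bochner_integral_integrable int\<psi>)
    then show ?thesis by (simp add: has_bochner_integral_integral_eq)
  qed
  have "(\<lambda>n. \<integral>x. q n x \<partial>lborel) \<longlonglongrightarrow> (\<integral>x. D x \<bullet> e \<partial>lborel)"
  proof (rule integral_dominated_convergence)
    \<comment> \<open>The steps have norm at most \<open>norm e\<close>, so all quotients vanish
      outside the ball of radius \<open>r + norm e\<close>.\<close>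
    show "integrable lborel (\<lambda>x. indicator (cball 0 (r + norm e)) x *\<^sub>R (M * norm e) :: real)"
      by (intro borel_integrable_compact continuous_intros) auto
    show "AE x in lborel. (\<lambda>n. q n x) \<longlonglongrightarrow> D x \<bullet> e"
    proof (rule AE_I2)
      fix x
      have "((\<lambda>h::real. \<psi> (x + h *\<^sub>R e)) has_derivative (\<lambda>h. D (x + 0 *\<^sub>R e) \<bullet> (h *\<^sub>R e))) (at 0)"
        by (rule has_derivative_compose[OF _ der]) (auto intro!: derivative_eq_intros)
      then have "((\<lambda>h. \<psi> (x + h *\<^sub>R e)) has_real_derivative D x \<bullet> e) (at 0)"
        unfolding has_field_derivative_def by (rule has_derivative_eq_rhs) (simp add: fun_eq_iff mult.commute)
      then have "((\<lambda>h. (\<psi> (x + h *\<^sub>R e) - \<psi> x) / h) \<longlongrightarrow> D x \<bullet> e) (at 0)"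
        by (simp add: DERIV_def)
      moreover have "filterlim (\<lambda>n. 1 / real (Suc n)) (at 0) sequentially"
        unfolding filterlim_at using LIMSEQ_inverse_real_of_nat by (auto simp: inverse_eq_divide)
      ultimately have "(\<lambda>n. (\<psi> (x + (1 / real (Suc n)) *\<^sub>R e) - \<psi> x) / (1 / real (Suc n))) \<longlonglongrightarrow> D x \<bullet> e"
        by (rule filterlim_compose)
      then show "(\<lambda>n. q n x) \<longlonglongrightarrow> D x \<bullet> e" by (simp add: q_def mult.commute)
    qed
    fix n
    show "q n \<in> borel_measurable lborel" unfolding q_def by measurable
    show "AE x in lborel. norm (q n x) \<le> indicator (cball 0 (r + norm e)) x *\<^sub>R (M * norm e)"
    proof (rule AE_I2)
      fix x
      let ?v = "(1 / real (Suc n)) *\<^sub>R e"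
      have nv: "norm ?v \<le> norm e" by (simp add: divide_le_eq mult_le_cancel_left1)
      show "norm (q n x) \<le> indicator (cball 0 (r + norm e)) x *\<^sub>R (M * norm e)"
      proof (cases "norm x \<le> r + norm e")
        case True
        have "norm (q n x) = real (Suc n) * \<bar>\<psi> (x + ?v) - \<psi> x\<bar>" by (simp add: q_def abs_mult)
        also have "\<dots> \<le> real (Suc n) * (M * norm ?v)" using lip[of "x + ?v" x] by (intro mult_left_mono) auto
        also have "\<dots> = M * norm e" by simp
        finally show ?thesis using True by simp
      next
        case False
        have "norm x \<le> norm (x + ?v) + norm ?v" using norm_triangle_ineq4[of "x + ?v" ?v] by simp
        then have "r < norm (x + ?v)" "r < norm x" using False nv norm_ge_zero[of e] by linarith+
        then show ?thesis using supp False by (simp add: q_def)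
      qed
    qed
  qed (use intD in auto)
  then show "(\<integral>x. D x \<bullet> e \<partial>lborel) = 0" by (simp add: q0 LIMSEQ_const_iff)
qed

context C1_disk
begin

lemma G_zero: "G x = 0" if "R < norm x"
proof -
  have "(f has_derivative (\<lambda>h. 0)) (at x)"
  proof (rule has_derivative_transform_within_open[of "\<lambda>_. 0"])
    show "open (- cball 0 R :: (real^2) set)" by auto
  qed (use that supp in auto)
  then have "(\<lambda>h. G x \<bullet> h) = (\<lambda>h. 0)" using has_derivative_unique[OF deriv] by blast
  then show ?thesis by (metis inner_eq_zero_iff)
qed

text \<open>For expressions such as \<open>(f x)\<^sup>2\<close> times a power of
  \<open>1 / (1 - x \<bullet> x)\<close>, singular only on the unit circle: the open disk and the
  complement of \<open>cball 0 R\<close> form an open cover.\<close>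

lemma continuous_on_extend_zero:
  fixes g :: "real^2 \<Rightarrow> 'b::real_normed_vector"
  assumes "continuous_on (ball 0 1) g" "\<And>x. R < norm x \<Longrightarrow> g x = 0"
  shows "continuous_on UNIV g"
proof -
  have "continuous_on (- cball 0 R) g"
    using assms(2) by (subst continuous_on_cong[of _ _ g "\<lambda>_. 0"]) (auto simp: not_le)
  then have "continuous_on (ball 0 1 \<union> - cball 0 R) g"
    using assms(1) by (intro continuous_on_open_Un) auto
  moreover have "ball 0 1 \<union> - cball 0 R = (UNIV :: (real^2) set)" using R by auto
  ultimately show ?thesis by simp
qed

text \<open>The divergence of the vector field \<open>x / (1 - |x|\<^sup>2)\<close> on the plane is \<open>2 / (1 - |x|\<^sup>2)\<^sup>2\<close>.\<close>

theorem hardy_inequality: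
  "(\<integral>\<^sup>+x. ennreal ((f x)\<^sup>2 * hyp_weight x) \<partial>lborel) \<le> (\<integral>\<^sup>+x. ennreal ((norm (G x))\<^sup>2) \<partial>lborel)"
proof -
  define q where "q x = 1 / (1 - x \<bullet> x)" for x :: "real^2"
  have q_pos: "1 - x \<bullet> x > 0" if "norm x < 1" for x :: "real^2"
    using that by (simp add: dot_square_norm abs_square_less_1)
  \<comment> \<open>\<open>D e\<close> is the gradient of the \<open>e\<close>-component of
    \<open>f\<^sup>2\<close> times the vector field, so that the sum of
    \<open>D e x \<bullet> e\<close> over the basis is a divergence.\<close>
  define D where "D e x = (2 * f x * (x \<bullet> e) * q x) *\<^sub>R G x + ((f x)\<^sup>2 * q x) *\<^sub>R e
      + ((f x)\<^sup>2 * (x \<bullet> e) * 2 * (q x)\<^sup>2) *\<^sub>R x" for e x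
  have f0: "f x = 0" if "R < norm x" for x using supp that by simp
  have contq: "continuous_on (ball 0 1) q"
  proof -
    have "1 - x \<bullet> x \<noteq> 0" if "x \<in> ball 0 1" for x :: "real^2"
      using q_pos[of x] that by simp
    then show ?thesis unfolding q_def by (intro continuous_intros) blast
  qed
  note cf = continuous_on_subset[OF cont subset_UNIV] and cG = continuous_on_subset[OF contG subset_UNIV]
  have contD: "continuous_on UNIV (D e)" for e
  proof (rule continuous_on_extend_zero)
    show "continuous_on (ball 0 1) (D e)" unfolding D_def by (intro continuous_intros contq cf cG)
  qed (simp add: D_def f0)
  have der: "((\<lambda>x. (f x)\<^sup>2 * (x \<bullet> e) * q x) has_derivative (\<lambda>h. D e x \<bullet> h)) (at x)" for e x
  proof (cases "norm x < 1")
    case True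
    have dq: "(q has_derivative (\<lambda>h. 2 * (q x)\<^sup>2 * (x \<bullet> h))) (at x)"
      unfolding q_def using q_pos[OF True]
      by (auto intro!: derivative_eq_intros simp: inner_commute power2_eq_square field_simps)
    have df: "((\<lambda>x. (f x)\<^sup>2) has_derivative (\<lambda>h. 2 * f x * (G x \<bullet> h))) (at x)"
      by (auto intro!: derivative_eq_intros deriv)
    have de: "((\<lambda>x. x \<bullet> e) has_derivative (\<lambda>h. h \<bullet> e)) (at x)"
      by (auto intro!: derivative_eq_intros)
    show ?thesis
      by (rule has_derivative_eq_rhs[OF has_derivative_mult[OF has_derivative_mult[OF df de] dq]])
         (simp add: D_def fun_eq_iff inner_add_left inner_commute algebra_simps)
  next
    case False
    then have "R < norm x" using R by simp
    then have "D e x = 0" by (simp add: D_def f0)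
    moreover have "((\<lambda>x. (f x)\<^sup>2 * (x \<bullet> e) * q x) has_derivative (\<lambda>h. 0)) (at x)"
    proof (rule has_derivative_transform_within_open[of "\<lambda>_. 0"])
      show "open (- cball 0 R :: (real^2) set)" by auto
    qed (use \<open>R < norm x\<close> f0 in auto)
    ultimately show ?thesis by simp
  qed
  note parts = integral_directional_derivative[OF der contD, of R]
  have int: "integrable lborel (\<lambda>x. D e x \<bullet> e)" and int0: "(\<integral>x. D e x \<bullet> e \<partial>lborel) = 0" for e
    using parts f0 by auto
  have div: "(\<Sum>e\<in>Basis. D e x \<bullet> e) = 2 * (f x * q x * (G x \<bullet> x)) + 2 * ((f x)\<^sup>2 * (q x)\<^sup>2)" for x
  proof -
    have "(\<Sum>e\<in>Basis. D e x \<bullet> e) = 2 * f x * q x * (\<Sum>e\<in>Basis. (x \<bullet> e) * (G x \<bullet> e))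
       + (f x)\<^sup>2 * q x * (\<Sum>e\<in>(Basis :: (real^2) set). e \<bullet> e) + (f x)\<^sup>2 * 2 * (q x)\<^sup>2 * (\<Sum>e\<in>Basis. (x \<bullet> e) * (x \<bullet> e))"
      by (simp add: D_def inner_add_left sum.distrib sum_distrib_left mult_ac)
    also have "\<dots> = 2 * f x * q x * (x \<bullet> G x) + (f x)\<^sup>2 * q x * 2 + (f x)\<^sup>2 * 2 * (q x)\<^sup>2 * (x \<bullet> x)"
      by (simp add: euclidean_inner[symmetric])
    also have "\<dots> = 2 * (f x * q x * (G x \<bullet> x)) + 2 * ((f x)\<^sup>2 * (q x)\<^sup>2)"
    proof (cases "norm x < 1")
      case True
      \<comment> \<open>The divergence 2 of the identity field of the plane contributes
        \<open>2 * q x\<close>; this identity merges it with the derivative of \<open>q\<close> into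
        \<open>2 * (q x)\<^sup>2\<close>.\<close>
      have "q x = (q x)\<^sup>2 * (1 - x \<bullet> x)"
        using q_pos[OF True] by (simp add: q_def power2_eq_square)
      then have "(f x)\<^sup>2 * q x + (f x)\<^sup>2 * (q x)\<^sup>2 * (x \<bullet> x) = (f x)\<^sup>2 * (q x)\<^sup>2"
        by (metis add_diff_cancel diff_add_cancel distrib_left mult.assoc mult.right_neutral right_diff_distrib)
      then show ?thesis by (simp add: inner_commute)
    qed (use f0 R in simp)
    finally show ?thesis .
  qed
  have intq: "integrable lborel (\<lambda>x. (f x)\<^sup>2 * (q x)\<^sup>2)"
  proof (rule integrable_continuous_compact_support[of _ R])
    show "continuous_on UNIV (\<lambda>x. (f x)\<^sup>2 * (q x)\<^sup>2)"
      by (rule continuous_on_extend_zero) (auto intro!: continuous_intros contq cf simp: f0)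
  qed (simp add: f0)
  have intG: "integrable lborel (\<lambda>x. (norm (G x))\<^sup>2)"
    by (rule integrable_continuous_compact_support[of _ R]) (auto intro!: continuous_intros contG simp: G_zero)
  have intm: "integrable lborel (\<lambda>x. f x * q x * (G x \<bullet> x))"
  proof (rule integrable_continuous_compact_support[of _ R])
    show "continuous_on UNIV (\<lambda>x. f x * q x * (G x \<bullet> x))"
      by (rule continuous_on_extend_zero) (auto intro!: continuous_intros contq cf cG simp: f0)
  qed (simp add: f0)
  have "0 = (\<integral>x. (\<Sum>e\<in>Basis. D e x \<bullet> e) \<partial>lborel)"
    by (subst Bochner_Integration.integral_sum) (auto simp: int int0)
  also have "\<dots> = 2 * (\<integral>x. f x * q x * (G x \<bullet> x) \<partial>lborel) + 2 * (\<integral>x. (f x)\<^sup>2 * (q x)\<^sup>2 \<partial>lborel)"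
    unfolding div using intm intq by (subst Bochner_Integration.integral_add) auto
  finally have "(\<integral>x. (f x)\<^sup>2 * (q x)\<^sup>2 \<partial>lborel) = (\<integral>x. - (f x * q x * (G x \<bullet> x)) \<partial>lborel)" by simp
  \<comment> \<open>Young's inequality with equal halves: the half of the left side is absorbed,
    which leaves the constant 1.\<close>
  also have "\<dots> \<le> (\<integral>x. 1 / 2 * ((f x)\<^sup>2 * (q x)\<^sup>2) + 1 / 2 * (norm (G x))\<^sup>2 \<partial>lborel)"
  proof (rule integral_mono)
    fix x
    show "- (f x * q x * (G x \<bullet> x)) \<le> 1 / 2 * ((f x)\<^sup>2 * (q x)\<^sup>2) + 1 / 2 * (norm (G x))\<^sup>2"
    proof (cases "norm x < 1")
      case True
      have "\<bar>G x \<bullet> x\<bar> \<le> norm (G x) * norm x" by (rule Cauchy_Schwarz_ineq2)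
      also have "\<dots> \<le> norm (G x)" using True by (simp add: mult_left_le)
      finally have "\<bar>f x * q x\<bar> * \<bar>G x \<bullet> x\<bar> \<le> \<bar>f x * q x\<bar> * norm (G x)" by (intro mult_left_mono) auto
      then have "- (f x * q x * (G x \<bullet> x)) \<le> \<bar>f x * q x\<bar> * norm (G x)"
        by (metis abs_ge_minus_self abs_mult order_trans)
      also have "0 \<le> (\<bar>f x * q x\<bar> - norm (G x))\<^sup>2" by simp
      then have "\<bar>f x * q x\<bar> * norm (G x) \<le> 1 / 2 * (f x * q x)\<^sup>2 + 1 / 2 * (norm (G x))\<^sup>2"
        by (simp add: power2_diff)
      finally show ?thesis by (simp add: power_mult_distrib)
    qed (use f0 R in simp)
  qed (use intm intq intG in auto)
  also have "\<dots> = 1 / 2 * (\<integral>x. (f x)\<^sup>2 * (q x)\<^sup>2 \<partial>lborel) + 1 / 2 * (\<integral>x. (norm (G x))\<^sup>2 \<partial>lborel)"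
    using intq intG by (subst Bochner_Integration.integral_add) auto
  finally have "(\<integral>x. (f x)\<^sup>2 * (q x)\<^sup>2 \<partial>lborel) \<le> (\<integral>x. (norm (G x))\<^sup>2 \<partial>lborel)" by simp
  then have "ennreal (\<integral>x. (f x)\<^sup>2 * (q x)\<^sup>2 \<partial>lborel) \<le> ennreal (\<integral>x. (norm (G x))\<^sup>2 \<partial>lborel)" by (rule ennreal_leI)
  moreover have eq: "(\<lambda>x. (f x)\<^sup>2 * (q x)\<^sup>2) = (\<lambda>x. (f x)\<^sup>2 * hyp_weight x)"
    by (simp add: q_def hyp_weight_def power_one_over dot_square_norm)
  moreover have "(\<integral>\<^sup>+x. ennreal ((f x)\<^sup>2 * hyp_weight x) \<partial>lborel) = ennreal (\<integral>x. (f x)\<^sup>2 * hyp_weight x \<partial>lborel)"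
    by (rule nn_integral_eq_integral) (use intq in \<open>auto simp: eq\<close>)
  moreover have "(\<integral>\<^sup>+x. ennreal ((norm (G x))\<^sup>2) \<partial>lborel) = ennreal (\<integral>x. (norm (G x))\<^sup>2 \<partial>lborel)"
    by (rule nn_integral_eq_integral) (use intG in auto)
  ultimately show ?thesis by (simp only:)
qed

end

text \<open>Shifts of this function build a truncation with continuous derivative, as
  \<open>C1_disk\<close> demands; \<open>max\<close> and \<open>min\<close> alone would not
  do.\<close>

lemma DERIV_square_pos_part:
  "((\<lambda>t::real. (max 0 t)\<^sup>2) has_real_derivative 2 * max 0 t) (at t)"
proof -
  consider "t < 0" | "t > 0" | "t = 0" by linarith
  then show ?thesis
  proof cases
    case 1
    have "((\<lambda>t::real. 0) has_real_derivative 0) (at t)" by simp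
    then show ?thesis using 1
      by (subst DERIV_cong_ev[OF refl _ refl, of _ "\<lambda>_. 0"])
         (auto intro!: eventually_mono[OF eventually_nhds_in_open[of "{..<0}"]])
  next
    case 2
    have "((\<lambda>t::real. t\<^sup>2) has_real_derivative 2 * t) (at t)" by (auto intro!: derivative_eq_intros)
    then show ?thesis using 2
      by (subst DERIV_cong_ev[OF refl _ refl, of _ "\<lambda>t. t\<^sup>2"])
         (auto intro!: eventually_mono[OF eventually_nhds_in_open[of "{0<..}"]])
  next
    case 3
    have "((\<lambda>h::real. max 0 h) \<longlongrightarrow> max 0 0) (at 0)" by (intro tendsto_intros)
    then have "((\<lambda>h::real. max 0 h) \<longlongrightarrow> 0) (at 0)" by simp
    then have "((\<lambda>h::real. (max 0 h)\<^sup>2 / h) \<longlongrightarrow> 0) (at 0)"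
      by (rule Lim_transform_eventually) (auto simp: eventually_at_filter max_def power2_eq_square)
    then show ?thesis using 3 by (simp add: DERIV_def)
  qed
qed

subsection \<open>Decay of the level sets\<close>

text \<open>Writing \<open>h t\<close> for the deficit of \<open>exp t * m t\<close> in logarithmic scale, the two capacity
  inequalities for the levels between 1 and \<open>t\<^sub>0\<close> and between \<open>t\<^sub>0\<close> and \<open>t\<^sub>1\<close> give
  \<open>h t\<^sub>0 + h t\<^sub>1 \<ge> (t\<^sub>1 - t\<^sub>0) / 4 - C\<close>. Hence \<open>exp t * m t\<close> decays exponentially away from a
  level that almost minimizes \<open>h\<close>.\<close>

lemma level_decay:
  fixes m :: "real \<Rightarrow> real" and e :: "real \<Rightarrow> real \<Rightarrow> real"
  assumes C: "C > 0" and m0: "m 1 > 0" and m_nonneg: "\<And>t. 0 \<le> m t"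
    and anti: "\<And>s t. 1 \<le> s \<Longrightarrow> s \<le> t \<Longrightarrow> m t \<le> m s"
    and e: "\<And>s t. 0 \<le> e s t"
    and cap: "\<And>s t. 1 \<le> s \<Longrightarrow> s < t \<Longrightarrow> m t > 0 \<Longrightarrow> 4 * pi * (t - s)\<^sup>2 \<le> e s t * (ln (m s / m t) + C)"
    and E: "\<And>s t. 1 \<le> s \<Longrightarrow> s \<le> t \<Longrightarrow> e 1 s + e s t \<le> E"
  obtains t0 where "\<And>t. t \<ge> 1 \<Longrightarrow> exp t * m t \<le> exp (3 / 2 + 3 / 2 * C) * m 1 * exp (E / (16 * pi)) * exp (- \<bar>t - t0\<bar> / 8)"
proof -
  \<comment> \<open>By this choice
    \<open>exp t * m t = m 1 * exp (E / (16 * pi) + 1 + C - h t)\<close> wherever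
    \<open>m t > 0\<close>, so lower bounds on \<open>h\<close> are what is needed.\<close>
  define h where "h t = E / (16 * pi) - (t - 1) + ln (m 1 / m t) + C" for t
  define S where "S = {t. t \<ge> 1 \<and> m t > 0}"
  have cap': "4 * pi * (t - s)\<^sup>2 \<le> e s t * (ln (m s / m t) + C)" "0 \<le> ln (m s / m t)" "0 < m s"
    if "1 \<le> s" "s \<le> t" "m t > 0" for s t
  proof -
    have ms: "m t \<le> m s" using anti that by blast
    then show "0 < m s" using that by linarith
    show ln: "0 \<le> ln (m s / m t)" using ms that by simp
    show "4 * pi * (t - s)\<^sup>2 \<le> e s t * (ln (m s / m t) + C)"
    proof (cases "s = t")
      case True
      then show ?thesis using e[of s t] ln C by simp
    next
      case False
      then show ?thesis using cap[of s t] that by simp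
    qed
  qed
  have amgm: "b * u \<le> x + y" if "b\<^sup>2 * u\<^sup>2 \<le> 4 * (x * y)" "0 \<le> x" "0 \<le> y" for b u x y :: real
  proof (rule power2_le_imp_le)
    have "4 * (x * y) \<le> (x + y)\<^sup>2"
      using zero_le_power2[of "x - y"] by (simp add: power2_sum power2_diff)
    then show "(b * u)\<^sup>2 \<le> (x + y)\<^sup>2" using that by (simp add: power_mult_distrib)
  qed (use that in simp)
  have pair: "(t1 - t0) / 4 - C \<le> h t0 + h t1" "0 \<le> h t0" if t: "1 \<le> t0" "t0 \<le> t1" "m t1 > 0" for t0 t1
  proof -
    have mt0: "m t0 > 0" using cap'(3)[OF t] .
    define L0 where "L0 = ln (m 1 / m t0) + C"
    define L where "L = ln (m t0 / m t1) + C"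
    have L0: "L0 > 0" "4 * pi * (t0 - 1)\<^sup>2 \<le> e 1 t0 * L0"
      unfolding L0_def using add_nonneg_pos[OF cap'(2)[OF order_refl t(1) mt0] C] cap'(1)[OF order_refl t(1) mt0]
      by blast+
    have L: "L > 0" "4 * pi * (t1 - t0)\<^sup>2 \<le> e t0 t1 * L"
      unfolding L_def using add_nonneg_pos[OF cap'(2)[OF t] C] cap'(1)[OF t] by blast+
    \<comment> \<open>\<open>L0\<close> and \<open>L\<close> both contain \<open>C\<close>, the left
      side only once.\<close>
    have lnL: "ln (m 1 / m t1) + C = L0 + L - C"
      using m0 mt0 t by (simp add: L0_def L_def ln_div)
    have a0: "1 * (t0 - 1) \<le> e 1 t0 / (16 * pi) + L0"
    proof (rule amgm)
      have "(t0 - 1)\<^sup>2 \<le> e 1 t0 * L0 / (4 * pi)" using L0(2) by (simp add: pos_le_divide_eq mult.commute)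
      then show "1\<^sup>2 * (t0 - 1)\<^sup>2 \<le> 4 * (e 1 t0 / (16 * pi) * L0)" by (simp add: mult.commute)
    qed (use e L0 in auto)
    \<comment> \<open>In \<open>h t0 + h t1\<close> the term \<open>E / (16 * pi)\<close> occurs
      twice, so the energy of the upper slab may be counted twice as well. This admits every slope
      up to \<open>sqrt 2\<close> in place of 1; the surplus \<open>1 / 4\<close> of the slope
      \<open>5 / 4\<close> is the decay.\<close>
    have a1: "5 / 4 * (t1 - t0) \<le> e t0 t1 / (8 * pi) + L"
    proof (rule amgm)
      have "(t1 - t0)\<^sup>2 \<le> e t0 t1 * L / (4 * pi)" using L(2) by (simp add: pos_le_divide_eq mult.commute)
      moreover have "(5 / 4)\<^sup>2 * (t1 - t0)\<^sup>2 \<le> 2 * (t1 - t0)\<^sup>2"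
        by (intro mult_right_mono) (auto simp: power2_eq_square)
      ultimately have "(5 / 4)\<^sup>2 * (t1 - t0)\<^sup>2 \<le> 2 * (e t0 t1 * L / (4 * pi))" by linarith
      then show "(5 / 4)\<^sup>2 * (t1 - t0)\<^sup>2 \<le> 4 * (e t0 t1 / (8 * pi) * L)" by (simp add: mult.commute)
    qed (use e L in auto)
    define X X0 X1 where "X = E / (16 * pi)" and "X0 = e 1 t0 / (16 * pi)" and "X1 = e t0 t1 / (16 * pi)"
    have "(e 1 t0 + e t0 t1) / (16 * pi) \<le> X"
      unfolding X_def using E[of t0 t1] t by (intro divide_right_mono) auto
    then have E': "X0 + X1 \<le> X" by (simp add: X0_def X1_def add_divide_distrib)
    have half: "e t0 t1 / (8 * pi) = X1 + X1" by (simp add: X1_def)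
    have nn: "0 \<le> X1" using e by (simp add: X1_def)
    have h0: "h t0 = X - (t0 - 1) + L0" by (simp add: h_def L0_def X_def)
    have h1: "h t1 = X - (t1 - 1) + (L0 + L - C)" unfolding h_def using lnL by (simp add: X_def)
    have a0': "t0 - 1 \<le> X0 + L0" and a1': "5 / 4 * (t1 - t0) \<le> X1 + X1 + L"
      using a0 a1 unfolding half X0_def by simp_all
    show "0 \<le> h t0" unfolding h0 using E' nn a0' by linarith
    show "(t1 - t0) / 4 - C \<le> h t0 + h t1"
      unfolding h0 h1 using E' a0' a1' by (simp add: field_simps)
  qed
  have S1: "1 \<in> S" using m0 by (simp add: S_def)
  have h_nn: "0 \<le> h t" if "t \<in> S" for t using pair(2)[of t t] that by (simp add: S_def)
  \<comment> \<open>The infimum need not be attained; a level within 1 of it is enough.\<close>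
  define I where "I = Inf (h ` S)"
  have bdd: "bdd_below (h ` S)" using h_nn by (auto intro: bdd_belowI[of _ 0])
  obtain t0 where t0: "t0 \<in> S" "h t0 < I + 1"
    using cInf_lessD[of "h ` S" "I + 1"] S1 unfolding I_def by auto
  \<comment> \<open>The sum \<open>h t0 + h t\<close> is at most \<open>2 * h t + 1\<close>; halving
    turns the slope \<open>1 / 4\<close> into the rate \<open>1 / 8\<close>.\<close>
  have low: "(\<bar>t - t0\<bar> / 4 - C - 1) / 2 \<le> h t" if "t \<in> S" for t
  proof -
    have "h t0 \<le> h t + 1" using t0 cInf_lower[OF _ bdd, of "h t"] that unfolding I_def by fastforce
    moreover have "\<bar>t - t0\<bar> / 4 - C \<le> h t0 + h t"
      using pair(1)[of t0 t] pair(1)[of t t0] that t0 by (cases "t0 \<le> t") (auto simp: S_def)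
    ultimately show ?thesis by (simp add: field_simps)
  qed
  show thesis
  proof (rule that)
    fix t :: real assume t: "t \<ge> 1"
    show "exp t * m t \<le> exp (3 / 2 + 3 / 2 * C) * m 1 * exp (E / (16 * pi)) * exp (- \<bar>t - t0\<bar> / 8)"
    proof (cases "m t > 0")
      case True
      have "exp t * m t = exp t * exp (ln (m t))" using True by simp
      also have "\<dots> = m 1 * exp (t + (ln (m t) - ln (m 1)))" using m0 by (simp add: exp_add exp_diff)
      also have "t + (ln (m t) - ln (m 1)) = E / (16 * pi) + 1 + C - h t"
        using m0 True by (simp add: h_def ln_div)
      also have "m 1 * exp \<dots> \<le> m 1 * exp ((3 / 2 + 3 / 2 * C) + E / (16 * pi) + (- \<bar>t - t0\<bar> / 8))"
      proof (intro mult_left_mono iffD2[OF exp_le_cancel_iff])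
        have "X + 1 + C - h t \<le> (3 / 2 + 3 / 2 * C) + X + (- \<bar>t - t0\<bar> / 8)" for X
          using low[of t] t True by (simp add: S_def field_simps)
        then show "E / (16 * pi) + 1 + C - h t \<le> (3 / 2 + 3 / 2 * C) + E / (16 * pi) + (- \<bar>t - t0\<bar> / 8)" .
      qed (use m0 in simp)
      also have "\<dots> = exp (3 / 2 + 3 / 2 * C) * m 1 * exp (E / (16 * pi)) * exp (- \<bar>t - t0\<bar> / 8)"
        by (simp only: exp_add mult_ac)
      finally show ?thesis .
    next
      case False
      then have "m t = 0" using m_nonneg[of t] by simp
      then show ?thesis using m0 by simp
    qed
  qed
qed

text \<open>What matters is independence of \<open>t0\<close>, the level of concentration, whose
  position is not controlled.\<close>

lemma nn_integral_exp_abs: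
  assumes "c > 0"
  shows "(\<integral>\<^sup>+t. ennreal (exp (- \<bar>t - t0\<bar> / c)) \<partial>lborel) \<le> ennreal (2 * c)"
proof -
  have half: "(\<integral>\<^sup>+t. ennreal (exp (- t / c)) * indicator {0..} t \<partial>lborel) = ennreal c"
  proof -
    have "filterlim (\<lambda>t. (1 / c) * t) at_top at_top"
      by (rule filterlim_tendsto_pos_mult_at_top[OF tendsto_const _ filterlim_ident]) (use assms in simp)
    then have "filterlim (\<lambda>t. - t / c) at_bot at_top" by (simp add: filterlim_uminus_at_top)
    then have "((\<lambda>t. exp (- t / c)) \<longlongrightarrow> 0) at_top" by (rule filterlim_compose[OF exp_at_bot])
    then have lim: "((\<lambda>t. - c * exp (- t / c)) \<longlongrightarrow> - c * 0) at_top" by (intro tendsto_intros)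
    have "(\<integral>\<^sup>+t. ennreal (exp (- t / c)) * indicator {0..} t \<partial>lborel) = ennreal (- c * 0 - (- c * exp (- 0 / c)))"
      by (rule nn_integral_FTC_atLeast[OF _ _ _ lim]) (use assms in \<open>auto intro!: derivative_eq_intros\<close>)
    then show ?thesis by simp
  qed
  have "(\<integral>\<^sup>+t. ennreal (exp (- \<bar>t - t0\<bar> / c)) \<partial>lborel) = (\<integral>\<^sup>+t. ennreal (exp (- \<bar>t\<bar> / c)) \<partial>lborel)"
    using nn_integral_translate[of "\<lambda>t. ennreal (exp (- \<bar>t\<bar> / c))" "- t0"] by (simp add: add.commute)
  also have "\<dots> \<le> (\<integral>\<^sup>+t. ennreal (exp (- t / c)) * indicator {0..} t + ennreal (exp (- (- t) / c)) * indicator {0..} (- t) \<partial>lborel)"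
    by (intro nn_integral_mono) (auto simp: indicator_def abs_if)
  also have "\<dots> = ennreal c + (\<integral>\<^sup>+t. ennreal (exp (- (- t) / c)) * indicator {0..} (- t) \<partial>lborel)"
    by (subst nn_integral_add) (measurable, simp only: half)
  also have "(\<integral>\<^sup>+t. ennreal (exp (- (- t) / c)) * indicator {0..} (- t) \<partial>lborel) = ennreal c"
    using nn_integral_real_affine[of "\<lambda>t. ennreal (exp (- t / c)) * indicator {0..} t" "-1" 0] half by simp
  finally show ?thesis using assms by (simp add: ennreal_plus[symmetric] del: ennreal_plus)
qed

text \<open>Negative arguments are covered because the approximating test functions may change sign.
  For them compare \<open>exp x * (1 - x) \<le> 1\<close> with
  \<open>(1 + x + x\<^sup>2) * (1 - x) = 1 - x ^ 3 \<ge> 1\<close>.\<close>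

lemma exp_le_quadratic:
  fixes x :: real
  assumes "x \<le> 1"
  shows "exp x - 1 - x \<le> x\<^sup>2"
proof (cases "0 \<le> x")
  case True
  then show ?thesis using exp_bound[OF True assms] by simp
next
  case False
  have "1 + x + x\<^sup>2 > 0"
    using zero_le_power2[of "x + 1 / 2"] by (simp add: power2_eq_square algebra_simps)
  have "1 = exp x * exp (- x)" by (simp add: exp_minus)
  also have "\<dots> \<ge> exp x * (1 - x)" using exp_ge_add_one_self[of "- x"] by simp
  finally have "exp x * (1 - x) \<le> 1" .
  moreover have "1 \<le> (1 + x + x\<^sup>2) * (1 - x)"
  proof -
    have "(1 + x + x\<^sup>2) * (1 - x) = 1 - x ^ 3" by (simp add: algebra_simps power2_eq_square power3_eq_cube)
    moreover have "x ^ 3 \<le> 0" using False mult_nonneg_nonpos[of "x * x" x] by (simp add: power3_eq_cube)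
    ultimately show ?thesis by simp
  qed
  ultimately have "exp x * (1 - x) \<le> (1 + x + x\<^sup>2) * (1 - x)" by linarith
  then have "exp x \<le> 1 + x + x\<^sup>2" using False by (simp add: mult_le_cancel_right)
  then show ?thesis by simp
qed

section \<open>Hyperbolic area of a superlevel set\<close>

context C1_disk
begin

text \<open>Chebyshev's inequality and Hardy's inequality for a truncation of \<open>f\<close> that
  rises from 0 to 1 between the levels 0 and 1, so that only the energy of this slab enters. Its
  slope is at most 2, which costs the factor 4.\<close>

lemma superlevel_bound:
  "(\<integral>\<^sup>+x. indicator {x. 1 \<le> f x} x * ennreal (hyp_weight x) \<partial>lborel) \<le> 4 * energy 0 1"
proof -
  \<comment> \<open>The derivative is the tent over the interval from 0 to 1 with height 2 at
    \<open>1 / 2\<close>, hence of area 1.\<close>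
  define H where "H t = 2 * ((max 0 t)\<^sup>2 - 2 * (max 0 (t - 1 / 2))\<^sup>2 + (max 0 (t - 1))\<^sup>2)" for t :: real
  define H' where "H' t = 4 * (max 0 t - 2 * max 0 (t - 1 / 2) + max 0 (t - 1))" for t :: real
  have shift: "((\<lambda>t. (max 0 (t - c))\<^sup>2) has_real_derivative 2 * max 0 (t - c)) (at t)" for c t :: real
  proof -
    have "((\<lambda>t. t - c) has_real_derivative 1) (at t)" by (auto intro!: derivative_eq_intros)
    from DERIV_chain2[where f = "\<lambda>t. (max 0 t)\<^sup>2", OF DERIV_square_pos_part this] show ?thesis by simp
  qed
  have dH: "(H has_real_derivative H' t) (at t)" for t
    unfolding H_def
    by (rule DERIV_cong[OF DERIV_cmult[OF DERIV_add[OF DERIV_diff[OF shift[of 0 t, simplified]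
          DERIV_cmult[OF shift[of "1 / 2" t]]] shift[of 1 t]]]]) (simp add: H'_def)
  have H1: "H t = 1" if "1 \<le> t" for t
    using that by (simp add: H_def max_def power2_eq_square algebra_simps)
  have H'2: "\<bar>H' t\<bar> \<le> 2" "H' t = 0 \<or> (0 < t \<and> t < 1)" for t
    by (auto simp: H'_def max_def abs_if)
  interpret H: C1_disk "\<lambda>x. H (f x)" "\<lambda>x. H' (f x) *\<^sub>R G x" R
  proof
    show "((\<lambda>x. H (f x)) has_derivative (\<lambda>h. (H' (f x) *\<^sub>R G x) \<bullet> h)) (at x)" for x
      using has_derivative_compose[OF deriv dH[unfolded has_field_derivative_def]] by simp
    show "continuous_on UNIV (\<lambda>x. H' (f x) *\<^sub>R G x)"
      unfolding H'_def by (intro continuous_intros cont contG)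
    show "H (f x) = 0" if "R \<le> norm x" for x using supp[OF that] by (simp add: H_def)
  qed (use R in auto)
  have "(\<integral>\<^sup>+x. indicator {x. 1 \<le> f x} x * ennreal (hyp_weight x) \<partial>lborel)
    \<le> (\<integral>\<^sup>+x. ennreal ((H (f x))\<^sup>2 * hyp_weight x) \<partial>lborel)"
    by (intro nn_integral_mono) (auto simp: indicator_def H1)
  also have "\<dots> \<le> (\<integral>\<^sup>+x. ennreal ((norm (H' (f x) *\<^sub>R G x))\<^sup>2) \<partial>lborel)" by (rule H.hardy_inequality)
  also have "\<dots> \<le> (\<integral>\<^sup>+x. 4 * (indicator {x. 0 < f x \<and> f x < 1} x * ennreal ((norm (G x))\<^sup>2)) \<partial>lborel)"
  proof (intro nn_integral_mono)
    fix x
    show "ennreal ((norm (H' (f x) *\<^sub>R G x))\<^sup>2) \<le> 4 * (indicator {x. 0 < f x \<and> f x < 1} x * ennreal ((norm (G x))\<^sup>2))"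
    proof (cases "0 < f x \<and> f x < 1")
      case True
      have "\<bar>H' (f x)\<bar>\<^sup>2 \<le> 2\<^sup>2" by (intro power_mono H'2) auto
      then have "\<bar>H' (f x)\<bar>\<^sup>2 * (norm (G x))\<^sup>2 \<le> 4 * (norm (G x))\<^sup>2" by (intro mult_right_mono) auto
      then have "ennreal ((norm (H' (f x) *\<^sub>R G x))\<^sup>2) \<le> ennreal (4 * (norm (G x))\<^sup>2)"
        by (intro ennreal_leI) (simp add: power_mult_distrib)
      then show ?thesis using True by (simp add: ennreal_mult)
    next
      case False
      then show ?thesis using H'2(2)[of "f x"] by auto
    qed
  qed
  also have "\<dots> = 4 * energy 0 1" unfolding energy_def by (rule nn_integral_cmult) measurable
  finally show ?thesis .
qed

end

section \<open>Integration over the levels\<close>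

context C1_disk
begin

definition superlevel :: "real \<Rightarrow> ennreal" where
  "superlevel t = (\<integral>\<^sup>+x. indicator {x. t \<le> f x} x * ennreal (hyp_weight x) \<partial>lborel)"

definition total_energy :: ennreal where
  "total_energy = (\<integral>\<^sup>+x. ennreal ((norm (G x))\<^sup>2) \<partial>lborel)"

lemma superlevel_antimono: "s \<le> t \<Longrightarrow> superlevel t \<le> superlevel s"
  unfolding superlevel_def by (intro nn_integral_mono) (auto simp: indicator_def)

lemma total_energy_finite: "total_energy < top"
proof -
  have "integrable lborel (\<lambda>x. (norm (G x))\<^sup>2)"
    by (rule integrable_continuous_compact_support[of _ R]) (auto intro!: continuous_intros contG simp: G_zero)
  then show ?thesis unfolding total_energy_def by (subst nn_integral_eq_integral) auto
qed

lemma energy_add_le: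
  assumes "r \<le> s" "s \<le> t"
  shows "energy r s + energy s t \<le> energy r t"
proof -
  have "energy r s + energy s t = (\<integral>\<^sup>+x. indicator {x. r < f x \<and> f x < s} x * ennreal ((norm (G x))\<^sup>2)
      + indicator {x. s < f x \<and> f x < t} x * ennreal ((norm (G x))\<^sup>2) \<partial>lborel)"
    unfolding energy_def by (rule nn_integral_add[symmetric]) measurable
  also have "\<dots> \<le> energy r t"
    unfolding energy_def using assms by (intro nn_integral_mono) (auto simp: indicator_def)
  finally show ?thesis .
qed

lemma energy_le_total: "energy s t \<le> total_energy"
  unfolding energy_def total_energy_def by (intro nn_integral_mono) (auto simp: indicator_def)

lemma energy_finite: "energy s t < top"
  using energy_le_total total_energy_finite by (rule le_less_trans)

lemma superlevel_finite:
  assumes "1 \<le> t"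
  shows "superlevel t < top"
proof -
  have "superlevel t \<le> superlevel 1" using assms by (rule superlevel_antimono)
  also have "\<dots> \<le> 4 * energy 0 1" unfolding superlevel_def by (rule superlevel_bound)
  also have "\<dots> < top" using energy_finite[of 0 1] by (simp add: ennreal_mult_less_top)
  finally show ?thesis .
qed

text \<open>Enlarging \<open>{f > s}\<close> to \<open>{f \<ge> s}\<close> only increases the
  logarithm, so a single function of the level remains, as \<open>level_decay\<close>
  expects.\<close>

lemma capacity_estimate_real:
  assumes "1 \<le> s" "s < t" "enn2real (superlevel t) > 0"
  shows "4 * pi * (t - s)\<^sup>2 \<le> enn2real (energy s t) * (ln (enn2real (superlevel s) / enn2real (superlevel t)) + 3000)"
proof -
  let ?V = "\<integral>\<^sup>+x. indicator {x. s < f x} x * ennreal (hyp_weight x) \<partial>lborel"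
  let ?a = "enn2real (superlevel t)" and ?b = "enn2real ?V"
  have V: "superlevel t \<le> ?V" "?V \<le> superlevel s"
    unfolding superlevel_def using assms by (intro nn_integral_mono; auto simp: indicator_def)+
  have fin: "superlevel s < top" "superlevel t < top" using superlevel_finite assms by auto
  then have finV: "?V < top" using V by (auto intro: le_less_trans)
  have ab: "?a \<le> ?b" "?b \<le> enn2real (superlevel s)"
    using V fin finV by (auto intro: enn2real_mono)
  have "ennreal (4 * pi * (t - s)\<^sup>2) \<le> energy s t * ennreal (ln (?b / ?a) + 3000)"
  proof (rule capacity_estimate)
    show "(\<integral>\<^sup>+x. indicator {x. t \<le> f x} x * ennreal (hyp_weight x) \<partial>lborel) = ennreal ?a"
      using fin by (simp add: superlevel_def)
    show "?V = ennreal ?b" using finV by simp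
  qed (use assms ab in auto)
  also have "\<dots> \<le> energy s t * ennreal (ln (enn2real (superlevel s) / ?a) + 3000)"
    using ab assms by (intro mult_left_mono ennreal_leI add_right_mono) (auto intro!: divide_right_mono)
  also have "\<dots> = ennreal (enn2real (energy s t) * (ln (enn2real (superlevel s) / ?a) + 3000))"
    using energy_finite[of s t] ab assms by (subst ennreal_mult) auto
  finally show ?thesis using ab assms by (subst (asm) ennreal_le_iff) auto
qed

text \<open>On \<open>{f \<ge> 1}\<close> the value \<open>exp (f x)\<close> is \<open>exp 1\<close>
  plus the integral of \<open>exp t\<close> over \<open>1 \<le> t \<le> f x\<close>; then
  Fubini.\<close>

lemma exp_layer_cake:
  "(\<integral>\<^sup>+x. indicator {x. 1 \<le> f x} x * ennreal (exp (f x) * hyp_weight x) \<partial>lborel)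
    = ennreal (exp 1) * superlevel 1 + (\<integral>\<^sup>+t. indicator {1..} t * (ennreal (exp t) * superlevel t) \<partial>lborel)"
proof -
  let ?K = "\<lambda>x t. indicator {(x, t). t \<le> f x} (x, t) * (indicator {1..} t * (ennreal (exp t) * ennreal (hyp_weight x))) :: ennreal"
  have pt: "indicator {x. 1 \<le> f x} x * ennreal (exp (f x) * hyp_weight x)
    = ennreal (exp 1) * (indicator {x. 1 \<le> f x} x * ennreal (hyp_weight x)) + (\<integral>\<^sup>+t. ?K x t \<partial>lborel)" for x
  proof (cases "1 \<le> f x")
    case True
    have "(\<integral>\<^sup>+t. ?K x t \<partial>lborel) = (\<integral>\<^sup>+t. ennreal (hyp_weight x) * (ennreal (exp t) * indicator {1..f x} t) \<partial>lborel)"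
      by (intro nn_integral_cong) (auto simp: indicator_def mult.commute)
    also have "\<dots> = ennreal (hyp_weight x) * (\<integral>\<^sup>+t. ennreal (exp t) * indicator {1..f x} t \<partial>lborel)"
      by (rule nn_integral_cmult) measurable
    also have "(\<integral>\<^sup>+t. ennreal (exp t) * indicator {1..f x} t \<partial>lborel) = ennreal (exp (f x) - exp 1)"
      by (rule nn_integral_FTC_Icc) (use True in \<open>auto intro!: derivative_eq_intros\<close>)
    also have "ennreal (hyp_weight x) * ennreal (exp (f x) - exp 1) = ennreal (hyp_weight x * (exp (f x) - exp 1))"
      using True by (simp add: ennreal_mult)
    finally have "(\<integral>\<^sup>+t. ?K x t \<partial>lborel) = ennreal (hyp_weight x * (exp (f x) - exp 1))" .
    moreover have "ennreal (exp 1 * hyp_weight x) + ennreal (hyp_weight x * (exp (f x) - exp 1)) = ennreal (exp (f x) * hyp_weight x)"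
      using True by (subst ennreal_plus[symmetric]) (auto simp: algebra_simps intro: mult_left_mono)
    ultimately show ?thesis using True by (simp add: ennreal_mult)
  next
    case False
    then have "?K x t = 0" for t by (auto simp: indicator_def)
    then have "(\<integral>\<^sup>+t. ?K x t \<partial>lborel) = (\<integral>\<^sup>+(t::real). 0 \<partial>lborel)" by (intro nn_integral_cong)
    then show ?thesis using False by (simp only:) simp
  qed
  have "(\<integral>\<^sup>+x. indicator {x. 1 \<le> f x} x * ennreal (exp (f x) * hyp_weight x) \<partial>lborel)
    = (\<integral>\<^sup>+x. ennreal (exp 1) * (indicator {x. 1 \<le> f x} x * ennreal (hyp_weight x)) + (\<integral>\<^sup>+t. ?K x t \<partial>lborel) \<partial>lborel)"
    by (intro nn_integral_cong pt)
  also have "\<dots> = ennreal (exp 1) * superlevel 1 + (\<integral>\<^sup>+x. \<integral>\<^sup>+t. ?K x t \<partial>lborel \<partial>lborel)"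
    unfolding superlevel_def by (subst nn_integral_add, measurable, subst nn_integral_cmult, measurable)
  also have "(\<integral>\<^sup>+x. \<integral>\<^sup>+t. ?K x t \<partial>lborel \<partial>lborel) = (\<integral>\<^sup>+t. \<integral>\<^sup>+x. ?K x t \<partial>lborel \<partial>lborel)"
    by (rule lborel_pair.Fubini'[symmetric]) measurable
  also have "\<dots> = (\<integral>\<^sup>+t. indicator {1..} t * (ennreal (exp t) * superlevel t) \<partial>lborel)"
  proof (intro nn_integral_cong)
    fix t :: real
    have "(\<integral>\<^sup>+x. ?K x t \<partial>lborel) = (\<integral>\<^sup>+x. (indicator {1..} t * ennreal (exp t)) * (indicator {x. t \<le> f x} x * ennreal (hyp_weight x)) \<partial>lborel)"
      by (intro nn_integral_cong) (auto simp: indicator_def mult_ac)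
    also have "\<dots> = (indicator {1..} t * ennreal (exp t)) * superlevel t"
      unfolding superlevel_def by (rule nn_integral_cmult) measurable
    finally show "(\<integral>\<^sup>+x. ?K x t \<partial>lborel) = indicator {1..} t * (ennreal (exp t) * superlevel t)"
      by (simp add: mult_ac)
  qed
  finally show ?thesis .
qed

text \<open>The decay of the levels is applied with the energy above level 1 only. The energy
  \<open>e 0 1\<close> saved in the exponent pays for the factor \<open>m 1 \<le> 4 * e 0 1\<close>,
  whence \<open>64 * pi = 4 * (16 * pi)\<close>. The factor 16 is the integral of the exponential
  with rate \<open>1 / 8\<close> on both sides of \<open>t0\<close>.\<close>

lemma exp_superlevel_bound:
  "(\<integral>\<^sup>+x. indicator {x. 1 \<le> f x} x * ennreal (exp (f x) * hyp_weight x) \<partial>lborel)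
    \<le> ennreal (64 * pi * (exp 1 + 16 * exp 4502) * exp (enn2real total_energy / (16 * pi)))"
proof -
  define m where "m t = enn2real (superlevel t)" for t
  define e where "e s t = enn2real (energy s t)" for s t
  define E where "E = enn2real total_energy"
  have superlevel_eq: "superlevel t = ennreal (m t)" if "1 \<le> t" for t
    using superlevel_finite[OF that] by (simp add: m_def)
  have e_add: "e r s + e s t \<le> e r t" if "r \<le> s" "s \<le> t" for r s t
  proof -
    have "enn2real (energy r s + energy s t) \<le> e r t"
      unfolding e_def using energy_add_le[OF that] energy_finite by (intro enn2real_mono) auto
    then show ?thesis using energy_finite by (simp add: e_def enn2real_plus)
  qed
  have e_le: "e s t \<le> E" for s t
    unfolding e_def E_def using energy_le_total total_energy_finite by (intro enn2real_mono) auto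
  have e_nn: "0 \<le> e s t" for s t by (simp add: e_def)
  have m1: "m 1 \<le> 4 * e 0 1"
  proof -
    have "superlevel 1 \<le> ennreal (4 * e 0 1)"
      using superlevel_bound energy_finite[of 0 1] by (simp add: superlevel_def e_def ennreal_mult)
    then show ?thesis unfolding m_def using e_nn by (intro enn2real_leI) auto
  qed
  have Eex: "e 0 1 * exp ((E - e 0 1) / (16 * pi)) \<le> 16 * pi * exp (E / (16 * pi))"
  proof -
    have "e 0 1 / (16 * pi) \<le> exp (e 0 1 / (16 * pi))" using exp_ge_add_one_self[of "e 0 1 / (16 * pi)"] by linarith
    then have "e 0 1 \<le> 16 * pi * exp (e 0 1 / (16 * pi))" by (simp add: pos_divide_le_eq mult.commute)
    then have "e 0 1 * exp ((E - e 0 1) / (16 * pi)) \<le> 16 * pi * exp (e 0 1 / (16 * pi)) * exp ((E - e 0 1) / (16 * pi))"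
      by (intro mult_right_mono) auto
    also have "\<dots> = 16 * pi * exp (E / (16 * pi))" by (simp add: mult.assoc exp_add[symmetric] diff_divide_distrib)
    finally show ?thesis .
  qed
  show ?thesis
  proof (cases "m 1 > 0")
    case False
    then have "m 1 = 0" using enn2real_nonneg[of "superlevel 1"] unfolding m_def by linarith
    then have "superlevel 1 = 0" using superlevel_eq[of 1] by simp
    then have "superlevel t = 0" if "1 \<le> t" for t using superlevel_antimono[OF that] by simp
    then have "(\<integral>\<^sup>+t. indicator {1..} t * (ennreal (exp t) * superlevel t) \<partial>lborel) = (\<integral>\<^sup>+(t::real). 0 \<partial>lborel)"
      by (intro nn_integral_cong) (auto simp: indicator_def)
    then show ?thesis unfolding exp_layer_cake \<open>superlevel 1 = 0\<close> by simp
  next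
    case True
    define E' where "E' = E - e 0 1"
    obtain t0 where t0: "\<And>t. t \<ge> 1 \<Longrightarrow> exp t * m t \<le> exp (3 / 2 + 3 / 2 * 3000) * m 1 * exp (E' / (16 * pi)) * exp (- \<bar>t - t0\<bar> / 8)"
    proof (rule level_decay[of 3000 m e E'])
      show "m t \<le> m s" if "1 \<le> s" "s \<le> t" for s t
        unfolding m_def using that superlevel_antimono superlevel_finite by (intro enn2real_mono) auto
      show "4 * pi * (t - s)\<^sup>2 \<le> e s t * (ln (m s / m t) + 3000)" if "1 \<le> s" "s < t" "m t > 0" for s t
        using capacity_estimate_real that unfolding m_def e_def by blast
      show "e 1 s + e s t \<le> E'" if "1 \<le> s" "s \<le> t" for s t
        using e_add[of 1 s t] e_add[of 0 1 t] e_le[of 0 t] that by (simp add: E'_def)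
    qed (use True e_nn in \<open>auto simp: m_def\<close>)
    define B where "B = exp 4502 * m 1 * exp (E' / (16 * pi))"
    have B: "0 \<le> B" using True by (simp add: B_def)
    \<comment> \<open>The exponent is 4501.5, rounded up.\<close>
    have "exp (3 / 2 + 3 / 2 * 3000) \<le> exp (4502 :: real)" by (intro iffD2[OF exp_le_cancel_iff]) simp
    then have "exp (3 / 2 + 3 / 2 * 3000) * m 1 * exp (E' / (16 * pi)) \<le> B"
      unfolding B_def using True by (intro mult_right_mono) auto
    then have t0': "exp t * m t \<le> B * exp (- \<bar>t - t0\<bar> / 8)" if "t \<ge> 1" for t
      using order_trans[OF t0[OF that] mult_right_mono] by simp
    have "(\<integral>\<^sup>+t. indicator {1..} t * (ennreal (exp t) * superlevel t) \<partial>lborel)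
      \<le> (\<integral>\<^sup>+t. ennreal B * ennreal (exp (- \<bar>t - t0\<bar> / 8)) \<partial>lborel)"
    proof (intro nn_integral_mono)
      fix t :: real
      show "indicator {1..} t * (ennreal (exp t) * superlevel t) \<le> ennreal B * ennreal (exp (- \<bar>t - t0\<bar> / 8))"
      proof (cases "1 \<le> t")
        case True
        have "ennreal (exp t) * superlevel t = ennreal (exp t * m t)"
          unfolding superlevel_eq[OF True] by (rule ennreal_mult[symmetric]) (auto simp: m_def)
        also have "\<dots> \<le> ennreal (B * exp (- \<bar>t - t0\<bar> / 8))" by (intro ennreal_leI t0' True)
        also have "\<dots> = ennreal B * ennreal (exp (- \<bar>t - t0\<bar> / 8))" using B by (intro ennreal_mult) auto
        finally show ?thesis using True by simp
      qed simp
    qed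
    also have "\<dots> = ennreal B * (\<integral>\<^sup>+t. ennreal (exp (- \<bar>t - t0\<bar> / 8)) \<partial>lborel)"
      by (rule nn_integral_cmult) measurable
    also have "\<dots> \<le> ennreal B * ennreal (2 * 8)"
      by (intro mult_left_mono nn_integral_exp_abs) auto
    also have "\<dots> = ennreal (16 * B)" using B by (subst ennreal_mult[symmetric]) (auto simp: mult.commute)
    finally have tail: "(\<integral>\<^sup>+t. indicator {1..} t * (ennreal (exp t) * superlevel t) \<partial>lborel) \<le> ennreal (16 * B)" .
    have "(\<integral>\<^sup>+x. indicator {x. 1 \<le> f x} x * ennreal (exp (f x) * hyp_weight x) \<partial>lborel)
      \<le> ennreal (exp 1) * ennreal (m 1) + ennreal (16 * B)"
      unfolding exp_layer_cake superlevel_eq[OF order_refl] by (intro add_left_mono tail)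
    also have "\<dots> = ennreal (exp 1 * m 1 + 16 * B)"
      using B True by (simp add: ennreal_mult)
    also have "\<dots> \<le> ennreal (64 * pi * (exp 1 + 16 * exp 4502) * exp (E / (16 * pi)))"
    proof (rule ennreal_leI)
      have "1 \<le> exp (E' / (16 * pi))" using e_le[of 0 1] by (simp add: E'_def)
      then have "exp 1 * m 1 \<le> exp 1 * (m 1 * exp (E' / (16 * pi)))"
        using True by (intro mult_left_mono) (auto simp: mult_le_cancel_left1)
      then have "exp 1 * m 1 + 16 * B \<le> (exp 1 + 16 * exp 4502) * (m 1 * exp (E' / (16 * pi)))"
        by (simp add: B_def algebra_simps)
      also have "\<dots> \<le> (exp 1 + 16 * exp 4502) * (4 * e 0 1 * exp (E' / (16 * pi)))"
        by (intro mult_left_mono mult_right_mono m1) (auto intro: add_nonneg_nonneg)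
      also have "\<dots> = 4 * (exp 1 + 16 * exp 4502) * (e 0 1 * exp ((E - e 0 1) / (16 * pi)))"
        by (simp add: E'_def)
      also have "\<dots> \<le> 4 * (exp 1 + 16 * exp 4502) * (16 * pi * exp (E / (16 * pi)))"
        by (intro mult_left_mono Eex) (auto intro: add_nonneg_nonneg)
      also have "\<dots> = 64 * pi * (exp 1 + 16 * exp 4502) * exp (E / (16 * pi))" by simp
      finally show "exp 1 * m 1 + 16 * B \<le> 64 * pi * (exp 1 + 16 * exp 4502) * exp (E / (16 * pi))" .
    qed
    finally show ?thesis by (simp add: E_def)
  qed
qed

text \<open>Below level 1 the integrand is at most \<open>(f x)\<^sup>2\<close> times the weight, so
  Hardy's inequality bounds that part by the energy, and
  \<open>E \<le> 16 * pi * exp (E / (16 * pi))\<close> gives it the same form as the rest.\<close>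

theorem exp_integral_bound:
  "(\<integral>\<^sup>+x. ennreal ((exp (f x) - 1 - f x) * hyp_weight x) \<partial>lborel)
    \<le> ennreal ((16 * pi + 64 * pi * (exp 1 + 16 * exp 4502)) * exp (enn2real total_energy / (16 * pi)))"
proof -
  define E where "E = enn2real total_energy"
  have E: "total_energy = ennreal E" "0 \<le> E" using total_energy_finite by (auto simp: E_def)
  have "E / (16 * pi) \<le> exp (E / (16 * pi))" using exp_ge_add_one_self[of "E / (16 * pi)"] by linarith
  then have Eex: "E \<le> 16 * pi * exp (E / (16 * pi))" by (simp add: pos_divide_le_eq mult.commute)
  let ?T = "\<lambda>x. indicator {x. 1 \<le> f x} x * ennreal (exp (f x) * hyp_weight x)"
  have "(\<integral>\<^sup>+x. ennreal ((exp (f x) - 1 - f x) * hyp_weight x) \<partial>lborel)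
    \<le> (\<integral>\<^sup>+x. ennreal ((f x)\<^sup>2 * hyp_weight x) + ?T x \<partial>lborel)"
  proof (intro nn_integral_mono)
    fix x
    show "ennreal ((exp (f x) - 1 - f x) * hyp_weight x) \<le> ennreal ((f x)\<^sup>2 * hyp_weight x) + ?T x"
    proof (cases "1 \<le> f x")
      case True
      then have "(exp (f x) - 1 - f x) * hyp_weight x \<le> exp (f x) * hyp_weight x"
        by (intro mult_right_mono) auto
      then have "ennreal ((exp (f x) - 1 - f x) * hyp_weight x) \<le> ?T x" using True by (simp add: ennreal_leI)
      then show ?thesis by (rule order_trans) simp
    next
      case False
      then have "(exp (f x) - 1 - f x) * hyp_weight x \<le> (f x)\<^sup>2 * hyp_weight x"
        by (intro mult_right_mono exp_le_quadratic) auto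
      then have "ennreal ((exp (f x) - 1 - f x) * hyp_weight x) \<le> ennreal ((f x)\<^sup>2 * hyp_weight x)" by (rule ennreal_leI)
      then show ?thesis by (rule order_trans) simp
    qed
  qed
  also have "\<dots> = (\<integral>\<^sup>+x. ennreal ((f x)\<^sup>2 * hyp_weight x) \<partial>lborel) + (\<integral>\<^sup>+x. ?T x \<partial>lborel)"
    by (rule nn_integral_add) measurable
  also have "\<dots> \<le> ennreal E + ennreal (64 * pi * (exp 1 + 16 * exp 4502) * exp (E / (16 * pi)))"
    using hardy_inequality exp_superlevel_bound E(1) unfolding total_energy_def[symmetric] E_def[symmetric]
    by (intro add_mono) auto
  also have "\<dots> \<le> ennreal (16 * pi * exp (E / (16 * pi))) + ennreal (64 * pi * (exp 1 + 16 * exp 4502) * exp (E / (16 * pi)))"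
    by (intro add_mono ennreal_leI Eex order_refl)
  also have "\<dots> = ennreal ((16 * pi + 64 * pi * (exp 1 + 16 * exp 4502)) * exp (E / (16 * pi)))"
    by (subst ennreal_plus[symmetric]) (auto simp: distrib_right intro!: mult_nonneg_nonneg add_nonneg_nonneg)
  finally show ?thesis by (simp add: E_def)
qed

end

subsection \<open>Passage to the Sobolev space\<close>

definition exp_const :: real where
  "exp_const = 16 * pi + 64 * pi * (exp 1 + 16 * exp 4502)"

text \<open>The constant of the theorem is the logarithm of \<open>exp_const\<close> and has to be
  positive.\<close>

lemma exp_const_pos: "exp_const > 1"
proof -
  have "0 < 64 * pi * (exp 1 + 16 * exp 4502)" by (simp add: add_pos_pos)
  then show ?thesis unfolding exp_const_def using pi_gt3 by linarith
qed

lemma grad_inner: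
  assumes "f differentiable (at x)"
  shows "(f has_derivative (\<lambda>h. grad f x \<bullet> h)) (at x)"
proof -
  have D: "(f has_derivative frechet_derivative f (at x)) (at x)"
    using assms frechet_derivative_works by blast
  then interpret bounded_linear "frechet_derivative f (at x)" by (rule has_derivative_bounded_linear)
  have "frechet_derivative f (at x) h = grad f x \<bullet> h" for h
  proof -
    have "frechet_derivative f (at x) h = frechet_derivative f (at x) (\<Sum>b\<in>Basis. (h \<bullet> b) *\<^sub>R b)"
      by (simp add: euclidean_representation)
    also have "\<dots> = (\<Sum>b\<in>Basis. (h \<bullet> b) * frechet_derivative f (at x) b)" by (simp add: sum scaleR)
    also have "\<dots> = grad f x \<bullet> h" by (simp add: grad_def inner_sum_left mult.commute inner_commute[of h])
    finally show ?thesis .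
  qed
  then have "frechet_derivative f (at x) = (\<lambda>h. grad f x \<bullet> h)" by blast
  then show ?thesis using D by simp
qed

lemma test_function_C1_disk:
  assumes "\<phi> \<in> test_functions unit_disk"
  obtains R where "C1_disk \<phi> (grad \<phi>) R"
proof -
  have ck: "C_k (Suc 0) \<phi>" and K: "compact (closure {x. \<phi> x \<noteq> 0})" "closure {x. \<phi> x \<noteq> 0} \<subseteq> ball 0 1"
    using assms unfolding test_functions_def unit_disk_def by blast+
  have diff: "\<phi> differentiable (at x)" for x using ck by simp
  have cb: "continuous_on UNIV (\<lambda>x. grad \<phi> x \<bullet> b)" if "b \<in> Basis" for b using ck that by simp
  have contg: "continuous_on UNIV (grad \<phi>)"
    by (subst continuous_on_componentwise) (use cb in blast)
  obtain R where R: "0 < R" "R < 1" "\<And>x::real^2. R \<le> norm x \<Longrightarrow> \<phi> x = 0"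
  proof -
    let ?K = "closure {x. \<phi> x \<noteq> 0}"
    obtain r where r: "r < 1" "\<And>x::real^2. x \<in> ?K \<Longrightarrow> norm x \<le> r"
    proof (cases "?K = {}")
      case True
      then show ?thesis using that[of 0] by auto
    next
      case False
      obtain z where "z \<in> ?K" "\<forall>y\<in>?K. norm y \<le> norm z"
        using continuous_attains_sup[OF K(1) False, of norm] by (auto intro: continuous_intros)
      then show ?thesis using that[of "norm z"] K(2) by auto
    qed
    show thesis
    \<comment> \<open>A radius strictly between \<open>r\<close> and 1 makes \<open>\<phi>\<close>
      vanish on the closed set \<open>R \<le> norm x\<close>; the maximum with 0 ensures
      \<open>0 < R\<close>.\<close>
    proof (rule that[of "(1 + max 0 r) / 2"])
      fix x :: "real^2" assume *: "(1 + max 0 r) / 2 \<le> norm x"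
      show "\<phi> x = 0"
      proof (rule ccontr)
        assume "\<phi> x \<noteq> 0"
        then have "x \<in> ?K" using closure_subset[of "{x. \<phi> x \<noteq> 0}"] by (auto simp: subset_iff)
        then show False using r(1) r(2)[of x] * by (auto simp: max_def split: if_splits)
      qed
    qed (use r in auto)
  qed
  show thesis
    by (rule that[of R], rule C1_disk.intro) (fact grad_inner[OF diff] contg R)+
qed

lemma nn_integral_lebesgue_on:
  assumes "S \<in> sets lborel"
  shows "(\<integral>\<^sup>+x. f x \<partial>lebesgue_on S) = (\<integral>\<^sup>+x. f x * indicator S x \<partial>lborel)"
  using assms by (simp add: nn_integral_restrict_space nn_integral_completion)

lemma test_function_exp_bound:
  assumes "\<phi> \<in> test_functions unit_disk"
  shows "(\<integral>\<^sup>+x. ennreal ((exp (\<phi> x) - 1 - \<phi> x) / (1 - (norm x)\<^sup>2)\<^sup>2) \<partial>lebesgue_on unit_disk)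
    \<le> ennreal (exp_const * exp ((LINT x|lebesgue_on unit_disk. (norm (grad \<phi> x))\<^sup>2) / (16 * pi)))"
    and "\<phi> \<in> borel_measurable borel" "grad \<phi> \<in> borel_measurable borel"
    and "integrable (lebesgue_on unit_disk) (\<lambda>x. (\<phi> x)\<^sup>2)"
    and "integrable (lebesgue_on unit_disk) (\<lambda>x. (norm (grad \<phi> x))\<^sup>2)"
proof -
  obtain R where "C1_disk \<phi> (grad \<phi>) R" using test_function_C1_disk[OF assms] .
  then interpret C1_disk \<phi> "grad \<phi>" R .
  show meas: "\<phi> \<in> borel_measurable borel" "grad \<phi> \<in> borel_measurable borel" by measurable
  have disk: "unit_disk \<in> sets lborel" by (simp add: unit_disk_def)
  have int_on: "integrable (lebesgue_on unit_disk) g" "(LINT x|lebesgue_on unit_disk. g x) = (LINT x|lborel. g x)"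
    if g: "continuous_on UNIV g" "\<And>x. R < norm x \<Longrightarrow> g x = 0" for g :: "real^2 \<Rightarrow> real"
  proof -
    have gi: "integrable lborel g" using g by (rule integrable_continuous_compact_support)
    have eq: "(\<lambda>x. indicator unit_disk x * g x) = g"
      using g(2) R by (auto simp: fun_eq_iff indicator_def unit_disk_def not_less intro!: g(2))
    have [measurable]: "g \<in> borel_measurable borel" using g(1) borel_measurable_continuous_onI by blast
    show "integrable (lebesgue_on unit_disk) g"
      using disk gi by (subst integrable_restrict_space) (auto simp: eq integrable_completion)
    show "(LINT x|lebesgue_on unit_disk. g x) = (LINT x|lborel. g x)"
      using disk by (subst integral_restrict_space) (auto simp: eq integral_completion)
  qed
  show "integrable (lebesgue_on unit_disk) (\<lambda>x. (\<phi> x)\<^sup>2)"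
    by (rule int_on) (auto intro!: continuous_intros cont simp: supp)
  have G2: "continuous_on UNIV (\<lambda>x. (norm (grad \<phi> x))\<^sup>2)" by (intro continuous_intros contG)
  show "integrable (lebesgue_on unit_disk) (\<lambda>x. (norm (grad \<phi> x))\<^sup>2)"
    by (rule int_on) (auto simp: G_zero G2)
  have "total_energy = ennreal (LINT x|lborel. (norm (grad \<phi> x))\<^sup>2)"
    unfolding total_energy_def
    by (intro nn_integral_eq_integral integrable_continuous_compact_support[OF G2, of R]) (auto simp: G_zero)
  also have "(LINT x|lborel. (norm (grad \<phi> x))\<^sup>2) = (LINT x|lebesgue_on unit_disk. (norm (grad \<phi> x))\<^sup>2)"
    by (rule int_on(2)[symmetric]) (auto simp: G_zero G2)
  finally have "enn2real total_energy = (LINT x|lebesgue_on unit_disk. (norm (grad \<phi> x))\<^sup>2)" by simp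
  moreover have "(\<integral>\<^sup>+x. ennreal ((exp (\<phi> x) - 1 - \<phi> x) / (1 - (norm x)\<^sup>2)\<^sup>2) \<partial>lebesgue_on unit_disk)
    \<le> (\<integral>\<^sup>+x. ennreal ((exp (\<phi> x) - 1 - \<phi> x) * hyp_weight x) \<partial>lborel)"
    unfolding nn_integral_lebesgue_on[OF disk]
    by (intro nn_integral_mono) (auto simp: indicator_def hyp_weight_def)
  ultimately show "(\<integral>\<^sup>+x. ennreal ((exp (\<phi> x) - 1 - \<phi> x) / (1 - (norm x)\<^sup>2)\<^sup>2) \<partial>lebesgue_on unit_disk)
    \<le> ennreal (exp_const * exp ((LINT x|lebesgue_on unit_disk. (norm (grad \<phi> x))\<^sup>2) / (16 * pi)))"
    using exp_integral_bound unfolding exp_const_def by (auto intro: order_trans)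
qed

text \<open>The coefficient of \<open>(norm b)\<^sup>2\<close> can be taken arbitrarily close to 1,
  so that approximation does not spoil the factor \<open>1 / (16 * pi)\<close>.\<close>

lemma norm_sq_add_le:
  fixes a b :: "'a::real_inner"
  assumes "\<epsilon> > 0"
  shows "(norm a)\<^sup>2 \<le> (1 + \<epsilon>) * (norm b)\<^sup>2 + (1 + 1 / \<epsilon>) * (norm (b - a))\<^sup>2"
proof -
  have "norm a \<le> norm b + norm (b - a)" using norm_triangle_ineq4[of b "b - a"] by simp
  then have "(norm a)\<^sup>2 \<le> (norm b + norm (b - a))\<^sup>2" by (intro power_mono) auto
  also have "\<dots> \<le> (1 + \<epsilon>) * (norm b)\<^sup>2 + (1 + 1 / \<epsilon>) * (norm (b - a))\<^sup>2"
  proof -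
    have "0 \<le> (\<epsilon> * norm b - norm (b - a))\<^sup>2 / \<epsilon>" using assms by simp
    also have "\<dots> = \<epsilon> * (norm b)\<^sup>2 + 1 / \<epsilon> * (norm (b - a))\<^sup>2 - 2 * norm b * norm (b - a)"
      using assms by (simp add: power2_diff field_simps) (simp add: power2_eq_square)
    finally show ?thesis by (simp add: power2_sum algebra_simps)
  qed
  finally show ?thesis .
qed

text \<open>Fatou's lemma applies because the integrand is nonnegative. The energies of the test
  functions are at most \<open>(1 + \<epsilon>) * A\<close> plus a multiple of the squared gradient
  error, which tends to 0 for fixed \<open>\<epsilon>\<close>; only afterwards
  \<open>\<epsilon>\<close> tends to 0.\<close>

theorem exp_integral_bound_H1_0:
  assumes u: "u \<in> H1_0 unit_disk"
  shows "(\<integral>\<^sup>+x. ennreal ((exp (u x) - 1 - u x) / (1 - (norm x)\<^sup>2)\<^sup>2) \<partial>lebesgue_on unit_disk)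
    \<le> ennreal (exp_const * exp ((L2_norm unit_disk (weak_grad unit_disk u))\<^sup>2 / (16 * pi)))"
proof -
  let ?M = "lebesgue_on unit_disk" and ?g = "weak_grad unit_disk u"
  obtain \<phi> where \<phi>: "\<And>n. \<phi> n \<in> test_functions unit_disk"
    and lim: "(\<lambda>n. sqrt ((L2_norm unit_disk (\<lambda>x. u x - \<phi> n x))\<^sup>2
        + (L2_norm unit_disk (\<lambda>x. ?g x - grad (\<phi> n) x))\<^sup>2)) \<longlonglongrightarrow> 0"
    and "u \<in> H1 unit_disk"
    using u unfolding H1_0_def by blast
  then have "\<exists>g. has_weak_grad unit_disk u g" by (simp add: H1_def)
  then have "has_weak_grad unit_disk u ?g" unfolding weak_grad_def by (rule someI_ex)
  then have uL2: "u \<in> borel_measurable ?M" "integrable ?M (\<lambda>x. (u x)\<^sup>2)"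
    and gL2: "?g \<in> borel_measurable ?M" "integrable ?M (\<lambda>x. (norm (?g x))\<^sup>2)"
    unfolding has_weak_grad_def L2_def by auto
  note [measurable] = uL2(1) gL2(1)
  have borel_M: "h \<in> borel_measurable ?M" if "h \<in> borel_measurable borel" for h :: "real^2 \<Rightarrow> 'b::topological_space"
    using that by (intro measurable_restrict_space1 measurable_completion) simp
  have [measurable]: "\<phi> n \<in> borel_measurable ?M" "grad (\<phi> n) \<in> borel_measurable ?M" for n
    using test_function_exp_bound(2,3)[OF \<phi>] by (auto intro: borel_M)
  have [measurable]: "(\<lambda>x::real^2. x) \<in> borel_measurable ?M" by (rule borel_M) simp
  note \<phi>2 = test_function_exp_bound(4)[OF \<phi>] and g\<phi>2 = test_function_exp_bound(5)[OF \<phi>]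
  define d where "d n = (LINT x|?M. (u x - \<phi> n x)\<^sup>2)" for n
  define dg where "dg n = (LINT x|?M. (norm (?g x - grad (\<phi> n) x))\<^sup>2)" for n
  have sq: "(L2_norm unit_disk (\<lambda>x. u x - \<phi> n x))\<^sup>2 = d n"
    "(L2_norm unit_disk (\<lambda>x. ?g x - grad (\<phi> n) x))\<^sup>2 = dg n" for n
    by (simp_all add: L2_norm_def d_def dg_def)
  have nn: "0 \<le> d n" "0 \<le> dg n" for n by (simp_all add: d_def dg_def)
  have "(\<lambda>n. (sqrt (d n + dg n))\<^sup>2) \<longlonglongrightarrow> 0\<^sup>2"
    using lim unfolding sq by (intro tendsto_power)
  then have sum0: "(\<lambda>n. d n + dg n) \<longlonglongrightarrow> 0" using nn by simp
  have d0: "d \<longlonglongrightarrow> 0" and dg0: "dg \<longlonglongrightarrow> 0"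
    by (rule tendsto_sandwich[OF _ _ tendsto_const sum0]; simp add: nn)+
  have int_d: "integrable ?M (\<lambda>x. (u x - \<phi> n x)\<^sup>2)" for n
  proof (rule Bochner_Integration.integrable_bound)
    show "integrable ?M (\<lambda>x. 2 * (u x)\<^sup>2 + 2 * (\<phi> n x)\<^sup>2)" using uL2 \<phi>2 by auto
    have "(a - b)\<^sup>2 \<le> 2 * a\<^sup>2 + 2 * b\<^sup>2" for a b :: real
      using zero_le_power2[of "a + b"] by (simp add: power2_sum power2_diff)
    then show "AE x in ?M. norm ((u x - \<phi> n x)\<^sup>2) \<le> norm (2 * (u x)\<^sup>2 + 2 * (\<phi> n x)\<^sup>2)" by simp
  qed measurable
  have int_dg: "integrable ?M (\<lambda>x. (norm (?g x - grad (\<phi> n) x))\<^sup>2)" for n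
  proof (rule Bochner_Integration.integrable_bound)
    show "integrable ?M (\<lambda>x. 2 * (norm (?g x))\<^sup>2 + 2 * (norm (grad (\<phi> n) x))\<^sup>2)" using gL2 g\<phi>2 by auto
    have "(norm (a - b))\<^sup>2 \<le> 2 * (norm a)\<^sup>2 + 2 * (norm b)\<^sup>2" for a b :: "real^2"
      using norm_sq_add_le[of 1 "a - b" a] by simp
    then show "AE x in ?M. norm ((norm (?g x - grad (\<phi> n) x))\<^sup>2) \<le> norm (2 * (norm (?g x))\<^sup>2 + 2 * (norm (grad (\<phi> n) x))\<^sup>2)" by simp
  qed measurable
  \<comment> \<open>Convergence in the mean yields convergence almost everywhere only along a
    subsequence.\<close>
  obtain r where r: "strict_mono r" and AE0: "AE x in ?M. (\<lambda>n. (u x - \<phi> (r n) x)\<^sup>2) \<longlonglongrightarrow> 0"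
  proof -
    have "(\<lambda>n. LINT x|?M. norm ((u x - \<phi> n x)\<^sup>2)) \<longlonglongrightarrow> 0" using d0 by (simp add: d_def[abs_def])
    from tendsto_L1_AE_subseq[OF int_d this] show ?thesis using that by blast
  qed
  define A where "A = (L2_norm unit_disk ?g)\<^sup>2"
  have A: "A = (LINT x|?M. (norm (?g x))\<^sup>2)" by (simp add: A_def L2_norm_def)
  define w where "w x = (1 - (norm x)\<^sup>2)\<^sup>2" for x :: "real^2"
  let ?F = "\<lambda>v x. ennreal ((exp (v x) - 1 - v x) / w x)"
  have main: "(\<integral>\<^sup>+x. ?F u x \<partial>?M) \<le> ennreal (exp_const * exp ((1 + \<epsilon>) * A / (16 * pi)))" if \<epsilon>: "\<epsilon> > 0" for \<epsilon>
  proof -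
    let ?b = "\<lambda>n. exp_const * exp (((1 + \<epsilon>) * A + (1 + 1 / \<epsilon>) * dg (r n)) / (16 * pi))"
    have Fn: "(\<integral>\<^sup>+x. ?F (\<phi> (r n)) x \<partial>?M) \<le> ennreal (?b n)" for n
    proof -
      have "(LINT x|?M. (norm (grad (\<phi> (r n)) x))\<^sup>2)
        \<le> (LINT x|?M. (1 + \<epsilon>) * (norm (?g x))\<^sup>2 + (1 + 1 / \<epsilon>) * (norm (?g x - grad (\<phi> (r n)) x))\<^sup>2)"
        using gL2 g\<phi>2 int_dg norm_sq_add_le[OF \<epsilon>] by (intro integral_mono) auto
      also have "\<dots> = (1 + \<epsilon>) * A + (1 + 1 / \<epsilon>) * dg (r n)"
        using gL2 int_dg by (simp add: A dg_def)
      finally have "exp_const * exp ((LINT x|?M. (norm (grad (\<phi> (r n)) x))\<^sup>2) / (16 * pi)) \<le> ?b n"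
        using exp_const_pos by (intro mult_left_mono iffD2[OF exp_le_cancel_iff] divide_right_mono) auto
      then show ?thesis using test_function_exp_bound(1)[OF \<phi>[of "r n"]] unfolding w_def
        by (meson ennreal_leI order_trans)
    qed
    have "(\<integral>\<^sup>+x. ?F u x \<partial>?M) \<le> (\<integral>\<^sup>+x. liminf (\<lambda>n. ?F (\<phi> (r n)) x) \<partial>?M)"
    proof (rule nn_integral_mono_AE)
      show "AE x in ?M. ?F u x \<le> liminf (\<lambda>n. ?F (\<phi> (r n)) x)"
        using AE0
      proof eventually_elim
        case (elim x)
        have "(\<lambda>n. sqrt ((u x - \<phi> (r n) x)\<^sup>2)) \<longlonglongrightarrow> sqrt 0" by (intro tendsto_intros elim)
        then have "(\<lambda>n. u x - \<phi> (r n) x) \<longlonglongrightarrow> 0" by (simp add: tendsto_rabs_zero_iff)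
        then have "(\<lambda>n. u x - (u x - \<phi> (r n) x)) \<longlonglongrightarrow> u x - 0" by (intro tendsto_intros)
        then have lim: "(\<lambda>n. \<phi> (r n) x) \<longlonglongrightarrow> u x" by simp
        have "(\<lambda>n. (exp (\<phi> (r n) x) - 1 - \<phi> (r n) x) * (1 / w x)) \<longlonglongrightarrow> (exp (u x) - 1 - u x) * (1 / w x)"
          by (intro tendsto_intros lim)
        then have "(\<lambda>n. ?F (\<phi> (r n)) x) \<longlonglongrightarrow> ?F u x" by (intro tendsto_ennrealI) simp
        then show ?case by (simp add: lim_imp_Liminf)
      qed
    qed
    also have "\<dots> \<le> liminf (\<lambda>n. \<integral>\<^sup>+x. ?F (\<phi> (r n)) x \<partial>?M)"
      unfolding w_def by (rule nn_integral_liminf) measurable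
    also have "\<dots> \<le> liminf (\<lambda>n. ennreal (?b n))"
      using Fn by (intro Liminf_mono) auto
    also have "\<dots> = ennreal (exp_const * exp ((1 + \<epsilon>) * A / (16 * pi)))"
    proof (rule lim_imp_Liminf)
      have "(\<lambda>n. dg (r n)) \<longlonglongrightarrow> 0" using LIMSEQ_subseq_LIMSEQ[OF dg0 r] by (simp add: o_def)
      then have "?b \<longlonglongrightarrow> exp_const * exp (((1 + \<epsilon>) * A + (1 + 1 / \<epsilon>) * 0) / (16 * pi))"
        by (intro tendsto_intros) auto
      then show "(\<lambda>n. ennreal (?b n)) \<longlonglongrightarrow> ennreal (exp_const * exp ((1 + \<epsilon>) * A / (16 * pi)))"
        by (intro tendsto_ennrealI) simp
    qed simp
    finally show ?thesis .
  qed
  have "(\<integral>\<^sup>+x. ?F u x \<partial>?M) \<le> ennreal (exp_const * exp ((1 + 0) * A / (16 * pi)))"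
  proof (rule tendsto_lowerbound)
    have "(\<lambda>\<epsilon>. exp_const * exp ((1 + \<epsilon>) * A / (16 * pi))) \<midarrow>0\<rightarrow> exp_const * exp ((1 + 0) * A / (16 * pi))"
      by (intro tendsto_intros) auto
    then have "((\<lambda>\<epsilon>. exp_const * exp ((1 + \<epsilon>) * A / (16 * pi))) \<longlongrightarrow> exp_const * exp ((1 + 0) * A / (16 * pi))) (at_right 0)"
      by (rule filterlim_mono[OF _ order_refl at_le]) simp
    then show "((\<lambda>\<epsilon>. ennreal (exp_const * exp ((1 + \<epsilon>) * A / (16 * pi)))) \<longlongrightarrow> ennreal (exp_const * exp ((1 + 0) * A / (16 * pi)))) (at_right 0)"
      by (rule tendsto_ennrealI)
    show "\<forall>\<^sub>F \<epsilon> in at_right 0. (\<integral>\<^sup>+x. ?F u x \<partial>?M) \<le> ennreal (exp_const * exp ((1 + \<epsilon>) * A / (16 * pi)))"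
      using main by (auto simp: eventually_at_filter)
  qed simp
  then show ?thesis by (simp add: A_def w_def)
qed

theorem theorem3p2:
  shows "\<exists>C::real. C > 0 \<and>
    (\<forall>u \<in> H1_0 unit_disk. (AE x in lebesgue_on unit_disk. u x \<ge> 0) \<longrightarrow>
      log_ennreal (\<integral>\<^sup>+ x. ennreal ((exp (u x) - 1 - u x) / (1 - (norm x)\<^sup>2)\<^sup>2)
          \<partial>lebesgue_on unit_disk)
        \<le> ereal (C + 1 / (16 * pi) * (L2_norm unit_disk (weak_grad unit_disk u))\<^sup>2))"
proof (intro exI[of _ "ln exp_const"] conjI ballI impI)
  show "0 < ln exp_const" using exp_const_pos by simp
  fix u assume u: "u \<in> H1_0 unit_disk"
  let ?I = "\<integral>\<^sup>+ x. ennreal ((exp (u x) - 1 - u x) / (1 - (norm x)\<^sup>2)\<^sup>2) \<partial>lebesgue_on unit_disk"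
  let ?A = "(L2_norm unit_disk (weak_grad unit_disk u))\<^sup>2"
  have bound: "?I \<le> ennreal (exp_const * exp (?A / (16 * pi)))" by (rule exp_integral_bound_H1_0[OF u])
  then have fin: "?I < top" by (rule le_less_trans) simp
  show "log_ennreal ?I \<le> ereal (ln exp_const + 1 / (16 * pi) * ?A)"
  \<comment> \<open>A vanishing integral has logarithm \<open>-\<infinity>\<close> and nothing is to
    show; otherwise the real logarithm of a positive number is meant.\<close>
  proof (cases "?I = 0")
    case False
    have pos: "0 < enn2real ?I" using False fin by (simp add: enn2real_positive_iff zero_less_iff_neq_zero)
    have "enn2real ?I \<le> exp_const * exp (?A / (16 * pi))"
      using bound exp_const_pos by (intro enn2real_leI) auto
    then have "ln (enn2real ?I) \<le> ln (exp_const * exp (?A / (16 * pi)))"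
      using pos by (intro ln_mono) auto
    also have "\<dots> = ln exp_const + ?A / (16 * pi)" using exp_const_pos by (simp add: ln_mult)
    finally show ?thesis using False fin by (simp add: log_ennreal_def)
  qed (simp add: log_ennreal_def)
qed

end
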